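(* Let $M$ be a connected matroid of rank $k$ on $n$ elements having a circuit-hyperplane $H$, and let $\widetilde{M}$ be the matroid obtained from $M$ by relaxing $H$. Let $i(M,t)$ and $i(\widetilde{M},t)$ be the Ehrhart polynomials of the matroid polytopes of $M$ and $\widetilde{M}$. Then \[ i(\widetilde{M},t) = i(M,t)+D_{k,n}(t-1),\] where $D_{k,n}(t)$ is the Ehrhart polynomial of the matroid polytope of the minimal matroid $T_{k,n}$. In particular, if $M$ is Ehrhart positive, then so is $\widetilde{M}$.
   Context: A hyperplane of a matroid of rank $k$ is a flat of rank $k-1$; a circuit-hyperplane is a subset that is both a circuit and a hyperplane. If $M$ has set of bases $\mathscr{B}$ and circuit-hyperplane $H$, then $\mathscr{B}\cup\{H\}$ is the set of bases of a matroid $\widetilde{M}$ on the same ground set, called the relaxation of $M$ at $H$. The matroid polytope of a matroid $M$ on $\{1,\dots,n\}$ is $\operatorname{conv}\{\sum_{i\in B}e_i : B\text{ a basis of } M\}\subseteq\mathbb{R}^n$; the Ehrhart polynomial $i(M,t)$ satisfies $i(M,t)=\#(t\mathscr{P}(M)\cap\mathbb{Z}^n)$ for integers $t\ge0$. A matroid is Ehrhart positive if all coefficients of the Ehrhart polynomial of its matroid polytope are positive. For integers $1\le k\le n-1$, $T_{k,n}$ denotes the cycle matroid of the graph obtained from a cycle of length $k+1$ by replacing one of its edges with $n-k$ parallel edges. *)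

theory Defs
  imports
    "HOL-Analysis.Analysis"
    "HOL-Library.Function_Algebras"
    "HOL-Computational_Algebra.Polynomial"
begin

section \<open>Real coordinate spaces indexed by an arbitrary type\<close>

text \<open>
  With the pointwise operations, the functions on a type form a real vector space, so that the
  library's convex hull applies to sets of functions.  For a finite set \<open>E\<close>, the space
  \<open>\<real>\<^sup>E\<close> is identified with the subspace of the functions that vanish outside \<open>E\<close>.
\<close>

instantiation "fun" :: (type, real_vector) real_vector
begin

definition "scaleR r f = (\<lambda>x. r *\<^sub>R f x)"

instance
  by standard (auto simp: scaleR_fun_def plus_fun_def scaleR_add_right scaleR_add_left)

end


section \<open>Matroids\<close>

record 'a basis_system =
  ground :: "'a set"
  bases :: "'a set set"

definition matroid :: "'a basis_system \<Rightarrow> bool" where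
  "matroid M \<longleftrightarrow>
     finite (ground M) \<and> bases M \<noteq> {} \<and> (\<forall>B \<in> bases M. B \<subseteq> ground M) \<and>
     (\<forall>B1 \<in> bases M. \<forall>B2 \<in> bases M. \<forall>x \<in> B1 - B2.
        \<exists>y \<in> B2 - B1. insert y (B1 - {x}) \<in> bases M)"

definition indep :: "'a basis_system \<Rightarrow> 'a set \<Rightarrow> bool" where
  "indep M X \<longleftrightarrow> (\<exists>B \<in> bases M. X \<subseteq> B)"

definition rk :: "'a basis_system \<Rightarrow> 'a set \<Rightarrow> nat" where
  "rk M X = Max (card ` {I. I \<subseteq> X \<and> indep M I})"

definition matroid_rank :: "'a basis_system \<Rightarrow> nat" where
  "matroid_rank M = rk M (ground M)"

definition circuit :: "'a basis_system \<Rightarrow> 'a set \<Rightarrow> bool" where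
  "circuit M C \<longleftrightarrow> C \<subseteq> ground M \<and> \<not> indep M C \<and> (\<forall>D. D \<subset> C \<longrightarrow> indep M D)"

definition flat :: "'a basis_system \<Rightarrow> 'a set \<Rightarrow> bool" where
  "flat M F \<longleftrightarrow> F \<subseteq> ground M \<and> (\<forall>e \<in> ground M - F. rk M (insert e F) > rk M F)"

definition hyperplane :: "'a basis_system \<Rightarrow> 'a set \<Rightarrow> bool" where
  "hyperplane M H \<longleftrightarrow> flat M H \<and> rk M H + 1 = matroid_rank M"

definition circuit_hyperplane :: "'a basis_system \<Rightarrow> 'a set \<Rightarrow> bool" where
  "circuit_hyperplane M H \<longleftrightarrow> circuit M H \<and> hyperplane M H"

definition matroid_connected :: "'a basis_system \<Rightarrow> bool" where
  "matroid_connected M \<longleftrightarrow>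
     (\<forall>e \<in> ground M. \<forall>f \<in> ground M. e \<noteq> f \<longrightarrow> (\<exists>C. circuit M C \<and> e \<in> C \<and> f \<in> C))"

definition relaxation :: "'a basis_system \<Rightarrow> 'a set \<Rightarrow> 'a basis_system" where
  "relaxation M H = \<lparr>ground = ground M, bases = insert H (bases M)\<rparr>"


section \<open>Cycle matroids and the minimal matroids\<close>

text \<open>
  An undirected multigraph is given by its set of edges and the map that sends an edge to its
  set of one or two end vertices; isolated vertices are irrelevant to the cycle matroid.
  The edge sequence \<open>es\<close> below is a cycle with vertex sequence \<open>vs\<close>.  Length 1 gives the
  loops and length 2 the pairs of parallel edges.
\<close>

definition graph_cycle :: "('e \<Rightarrow> 'v set) \<Rightarrow> 'e set \<Rightarrow> bool" where
  "graph_cycle ends C \<longleftrightarrow>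
     (\<exists>es vs. es \<noteq> [] \<and> length vs = length es \<and> distinct es \<and> distinct vs \<and> set es = C \<and>
        (\<forall>i < length es. ends (es ! i) = {vs ! i, vs ! (Suc i mod length es)}))"

definition graph_forest :: "('e \<Rightarrow> 'v set) \<Rightarrow> 'e set \<Rightarrow> bool" where
  "graph_forest ends X \<longleftrightarrow> \<not> (\<exists>C \<subseteq> X. graph_cycle ends C)"

definition cycle_matroid :: "'e set \<Rightarrow> ('e \<Rightarrow> 'v set) \<Rightarrow> 'e basis_system" where
  "cycle_matroid F ends =
     \<lparr>ground = F,
      bases = {X. X \<subseteq> F \<and> graph_forest ends X \<and>
                  (\<forall>Y. X \<subset> Y \<and> Y \<subseteq> F \<longrightarrow> \<not> graph_forest ends Y)}\<rparr>"

text \<open>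
  The cycle of length \<open>k + 1\<close> has the vertices \<open>0, \<dots>, k\<close>.  Its edge joining \<open>i - 1\<close> and \<open>i\<close>
  is labelled \<open>i\<close>, for \<open>1 \<le> i \<le> k\<close>.  The remaining edge, between \<open>k\<close> and \<open>0\<close>, is replaced
  with the \<open>n - k\<close> parallel edges \<open>k + 1, \<dots>, n\<close>.  The intended range is \<open>1 \<le> k \<le> n - 1\<close>.
\<close>

definition minimal_matroid :: "nat \<Rightarrow> nat \<Rightarrow> nat basis_system" where
  "minimal_matroid k n = cycle_matroid {1..n} (\<lambda>i. if i \<le> k then {i - 1, i} else {k, 0})"


section \<open>Matroid polytopes and Ehrhart polynomials\<close>

text \<open>The indicator function of \<open>B\<close> is the sum of the unit vectors \<open>e\<^sub>i\<close> over \<open>i \<in> B\<close>.\<close>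

definition matroid_polytope :: "'a basis_system \<Rightarrow> ('a \<Rightarrow> real) set" where
  "matroid_polytope M = convex hull ((\<lambda>B. indicator B) ` bases M)"

definition lattice_points :: "('a \<Rightarrow> real) set \<Rightarrow> nat \<Rightarrow> ('a \<Rightarrow> real) set" where
  "lattice_points P t = {x \<in> (\<lambda>y. real t *\<^sub>R y) ` P. \<forall>i. x i \<in> \<int>}"

definition ehrhart_poly :: "'a basis_system \<Rightarrow> real poly" where
  "ehrhart_poly M =
     (THE p. \<forall>t::nat. poly p (real t) = real (card (lattice_points (matroid_polytope M) t)))"

lemma ehrhart_poly_eqI:
  assumes "\<And>t::nat. poly p (real t) = real (card (lattice_points (matroid_polytope M) t))"
  shows "ehrhart_poly M = p"
  unfolding ehrhart_poly_def
proof (rule the_equality)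
  fix q :: "real poly"
  assume q: "\<forall>t::nat. poly q (real t) = real (card (lattice_points (matroid_polytope M) t))"
  have "range real \<subseteq> {x. poly (q - p) x = 0}"
    using q assms by auto
  moreover have "infinite (range real)"
    by (simp add: finite_image_iff inj_on_def)
  ultimately have "infinite {x. poly (q - p) x = 0}"
    using finite_subset by blast
  then show "q = p"
    using poly_roots_finite [of "q - p"] by auto
qed (use assms in simp)

definition ehrhart_positive :: "'a basis_system \<Rightarrow> bool" where
  "ehrhart_positive M \<longleftrightarrow> (\<forall>i \<le> degree (ehrhart_poly M). coeff (ehrhart_poly M) i > 0)"

end

theory Submission
  imports Defs
begin

text \<open>
  Ehrhart's theorem: each point of a lattice polytope has unique lexicographically largest
  barycentric weights with respect to the vertices.  Whether weights are largest depends on their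
  support only, and adding the first vertex to a support does not matter.  Splitting the weights
  of a lattice point of the dilate by \<open>t\<close> into integral and fractional parts writes the number of
  lattice points as a finite sum of binomial coefficients that are polynomials in \<open>t\<close>.

  Relaxation: the hyperplane \<open>x(H) = t (k - 1)\<close> cuts the dilate by \<open>t\<close> of the polytope of the
  relaxation.  The part \<open>x(H) \<le> t (k - 1)\<close> is the dilate for \<open>M\<close> itself, since a basis \<open>B\<close> that
  meets \<open>H\<close> in fewer than \<open>k - 1\<close> elements can trade an element with \<open>H\<close>, which turns both sets
  into bases of \<open>M\<close>.  The part beyond contains all points of the box with \<open>x(E) = t k\<close>, as all
  \<open>H - h + g\<close> are bases.  Its lattice points have \<open>x(H) = t k - s\<close> with \<open>s < t\<close>, and counting them
  by \<open>s\<close> gives \<open>\<Sum>s<t. (s + a choose a) (s + b choose b)\<close> for \<open>a = k - 1\<close> and \<open>b = n - k - 1\<close>.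
  The polytope of the minimal matroid has the same description with \<open>s \<le> t\<close>.

  Positivity: summation by parts gives a recursion in \<open>a\<close> for these sums without negative terms, so
  that they are polynomials in \<open>t\<close> without constant term whose other coefficients are positive.
\<close>

section \<open>Weak compositions\<close>

text \<open>Stars and bars, by splitting off the value at one element. Entries off \<open>A\<close>
  are fixed to be 0, so that functions stand for tuples; finiteness is carried along because
  \<open>card_SigmaI\<close> asks for it.\<close>

lemma weak_compositions:
  fixes A :: "'b set"
  assumes "finite A" "A \<noteq> {}"
  shows "finite {m :: 'b \<Rightarrow> nat. (\<forall>i. i \<notin> A \<longrightarrow> m i = 0) \<and> sum m A = s} \<and>
    card {m :: 'b \<Rightarrow> nat. (\<forall>i. i \<notin> A \<longrightarrow> m i = 0) \<and> sum m A = s}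
      = (s + (card A - 1)) choose (card A - 1)"
  using assms
proof (induction A arbitrary: s rule: finite_ne_induct)
  case (singleton a)
  have "{m :: 'b \<Rightarrow> nat. (\<forall>i. i \<notin> {a} \<longrightarrow> m i = 0) \<and> sum m {a} = s} = {(\<lambda>i. 0)(a := s)}"
    by auto
  then show ?case by simp
next
  case (insert a A)
  let ?C = "\<lambda>A s. {m :: 'b \<Rightarrow> nat. (\<forall>i. i \<notin> A \<longrightarrow> m i = 0) \<and> sum m A = s}"
  let ?T = "SIGMA j:{..s}. ?C A j"
  let ?f = "\<lambda>(j, m). m(a := s - j)"
  have upd: "sum (m(a := c)) A = sum m A" for m :: "'b \<Rightarrow> nat" and c
    using insert.hyps by (intro sum.cong) auto
  then have upd': "(\<Sum>x\<in>A. if x = a then c else m x) = sum m A" for m :: "'b \<Rightarrow> nat" and c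
    by (simp add: fun_upd_def)
  have bij: "bij_betw ?f ?T (?C (insert a A) s)"
  proof (rule bij_betw_byWitness[where f' = "\<lambda>m. (sum m A, m(a := 0))"])
    show "\<forall>p\<in>?T. (\<lambda>m. (sum m A, m(a := 0))) (?f p) = p"
      using insert.hyps by (auto simp: upd upd')
    show "\<forall>m\<in>?C (insert a A) s. ?f ((\<lambda>m. (sum m A, m(a := 0))) m) = m"
      using insert.hyps by auto
    show "?f ` ?T \<subseteq> ?C (insert a A) s"
      using insert.hyps by (auto simp: upd upd')
    show "(\<lambda>m. (sum m A, m(a := 0))) ` ?C (insert a A) s \<subseteq> ?T"
      using insert.hyps by (auto simp: upd upd')
  qed
  have fin: "finite ?T"
    using insert.IH by auto
  have "card (?C (insert a A) s) = card ?T"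
    using bij_betw_same_card[OF bij] by simp
  also have "\<dots> = (\<Sum>j\<le>s. (j + (card A - 1)) choose (card A - 1))"
    using insert.IH by (subst card_SigmaI) auto
  also have "\<dots> = (s + card A) choose (card A)"
  proof -
    obtain r where r: "card A = Suc r"
      using insert.hyps by (metis card_gt_0_iff gr0_implies_Suc)
    have "(\<Sum>j\<le>s. (j + r) choose r) = (s + Suc r) choose (Suc r)"
      by (induction s) auto
    then show ?thesis by (simp add: r)
  qed
  finally show ?case
    using bij_betw_finite[OF bij] fin insert.hyps by simp
qed


section \<open>Ehrhart's theorem for lattice polytopes\<close>

definition comb :: "nat \<Rightarrow> (nat \<Rightarrow> 'a \<Rightarrow> real) \<Rightarrow> (nat \<Rightarrow> real) \<Rightarrow> 'a \<Rightarrow> real" where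
  "comb N v l = (\<lambda>x. \<Sum>i<N. l i * v i x)"

definition weights :: "nat \<Rightarrow> real \<Rightarrow> (nat \<Rightarrow> real) set" where
  "weights N t = {l. (\<forall>i. 0 \<le> l i) \<and> (\<forall>i\<ge>N. l i = 0) \<and> sum l {..<N} = t}"

definition supp :: "('b \<Rightarrow> real) \<Rightarrow> 'b set" where
  "supp l = {i. l i \<noteq> 0}"

definition lexpos :: "(nat \<Rightarrow> real) \<Rightarrow> bool" where
  "lexpos d \<longleftrightarrow> (\<exists>j. d j > 0 \<and> (\<forall>i<j. d i = 0))"

text \<open>
  Weights are optimal if they are lexicographically largest among those of the same point.  As
  any direction \<open>d\<close> that is nonnegative off the support can be followed for a short while, this
  depends on the support only.
\<close>

definition optimal :: "nat \<Rightarrow> (nat \<Rightarrow> 'a \<Rightarrow> real) \<Rightarrow> nat set \<Rightarrow> bool" where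
  "optimal N v S \<longleftrightarrow> \<not> (\<exists>d. (\<forall>i\<ge>N. d i = 0) \<and> sum d {..<N} = 0 \<and> comb N v d = (\<lambda>_. 0) \<and>
     (\<forall>i. i \<notin> S \<longrightarrow> d i \<ge> 0) \<and> lexpos d)"

lemma lexpos_0: "lexpos d \<Longrightarrow> d 0 \<ge> 0"
  unfolding lexpos_def by (metis gr0I less_imp_le order_refl)

lemma optimalD:
  assumes "optimal N v S" "\<forall>i\<ge>N. d i = 0" "sum d {..<N} = 0" "comb N v d = (\<lambda>_. 0)"
    "\<forall>i. i \<notin> S \<longrightarrow> d i \<ge> 0"
  shows "\<not> lexpos d"
  using assms unfolding optimal_def by metis

text \<open>The triangulation formed by the optimal supports is a cone with apex \<open>0\<close>.\<close>

lemma optimal_insert_0: "optimal N v (insert 0 S) \<longleftrightarrow> optimal N v S"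
  unfolding optimal_def by (metis insert_iff lexpos_0)

lemma comb_add: "comb N v (\<lambda>i. l i + m i) = (\<lambda>x. comb N v l x + comb N v m x)"
  by (simp add: comb_def algebra_simps sum.distrib)

lemma comb_diff: "comb N v (\<lambda>i. l i - m i) = (\<lambda>x. comb N v l x - comb N v m x)"
  by (simp add: comb_def algebra_simps sum_subtractf)

lemma comb_scale: "comb N v (\<lambda>i. c * l i) = (\<lambda>x. c * comb N v l x)"
  by (simp add: comb_def algebra_simps sum_distrib_left)

text \<open>At the first index where the two differ, the difference taken towards the larger entry
  is \<open>lexpos\<close>. Off the support of the lexicographically smaller weights it is
  nonnegative, which contradicts their optimality.\<close>

lemma optimal_unique:
  assumes "l \<in> weights N t" "m \<in> weights N t" "optimal N v (supp l)" "optimal N v (supp m)"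
    and "comb N v l = comb N v m"
  shows "l = m"
proof (rule ccontr)
  assume "l \<noteq> m"
  define j where "j = (LEAST i. l i \<noteq> m i)"
  have "\<exists>i. l i \<noteq> m i" using \<open>l \<noteq> m\<close> by auto
  then have j: "l j \<noteq> m j" unfolding j_def by (rule LeastI_ex)
  have j': "l i = m i" if "i < j" for i
    using that not_less_Least[of i "\<lambda>i. l i \<noteq> m i"] unfolding j_def by blast
  have *: False if "l \<in> weights N t" "m \<in> weights N t" "optimal N v (supp l)"
    "comb N v l = comb N v m" "l j < m j" "\<And>i. i < j \<Longrightarrow> l i = m i" for l m
  proof -
    let ?d = "\<lambda>i. m i - l i"
    have "lexpos ?d" unfolding lexpos_def using that(5,6) by (intro exI[of _ j]) auto
    moreover have "\<forall>i. i \<notin> supp l \<longrightarrow> ?d i \<ge> 0" using that(2) by (auto simp: supp_def weights_def)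
    moreover have "sum ?d {..<N} = 0" using that(1,2) by (simp add: weights_def sum_subtractf)
    moreover have "comb N v ?d = (\<lambda>_. 0)" using that(4) by (simp add: comb_diff)
    moreover have "\<forall>i\<ge>N. ?d i = 0" using that(1,2) by (simp add: weights_def)
    ultimately show False
      using optimalD[OF that(3), of ?d] by simp
  qed
  show False
  proof (cases "l j < m j")
    case True
    then show ?thesis using *[of l m] assms j' by blast
  next
    case False
    then have "m j < l j" using j by simp
    then show ?thesis using *[of m l] assms j' by metis
  qed
qed

text \<open>In the product topology the fibre is a closed subset of a product of compact intervals,
  which is compact by Tychonoff's theorem.\<close>

lemma compact_fibre:
  "compact {l \<in> weights N t. comb N v l = x}"
proof -
  let ?B = "PiE UNIV (\<lambda>i::nat. if i < N then {0..t} else {0})"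
  have "compactin (product_topology (\<lambda>_. euclidean) UNIV) ?B"
    by (subst compactin_PiE) auto
  then have B: "compact ?B" by (simp add: euclidean_product_topology)
  have cont: "continuous_on UNIV (\<lambda>l::nat \<Rightarrow> real. l i)" for i
    by (rule continuous_on_product_coordinates)
  have "closed {l. sum l {..<N} = t}"
    by (intro closed_Collect_eq continuous_intros cont)
  moreover have "closed {l. comb N v l = x}"
  proof -
    have "closed {l. comb N v l y = x y}" for y
      unfolding comb_def by (intro closed_Collect_eq continuous_intros cont)
    moreover have "{l. comb N v l = x} = (\<Inter>y. {l. comb N v l y = x y})" by auto
    ultimately show ?thesis by auto
  qed
  ultimately have "compact (?B \<inter> ({l. sum l {..<N} = t} \<inter> {l. comb N v l = x}))"
    by (intro compact_Int_closed B closed_Int)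
  moreover have "{l \<in> weights N t. comb N v l = x}
      = ?B \<inter> ({l. sum l {..<N} = t} \<inter> {l. comb N v l = x})"
  proof -
    have "l i \<le> t" if "l \<in> weights N t" "i < N" for l i
      using that member_le_sum[of i "{..<N}" l] by (auto simp: weights_def)
    then show ?thesis
      by (auto simp: weights_def PiE_iff not_less split: if_splits)
        (metis atLeastAtMost_iff leI singleton_iff order_refl)+
  qed
  ultimately show ?thesis by simp
qed

text \<open>The entries are maximized one after the other, each over the compact set of weights that
  keep the earlier maxima. A direction violating optimality could be followed by a small step to
  weights that are larger at the first nonzero entry of the direction.\<close>

lemma optimal_exists:
  assumes "l0 \<in> weights N t"
  shows "\<exists>l \<in> weights N t. comb N v l = comb N v l0 \<and> optimal N v (supp l)"
proof -
  let ?F = "{l \<in> weights N t. comb N v l = comb N v l0}"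
  have ex: "\<exists>l\<in>?F. \<forall>j<n. \<forall>m\<in>?F. (\<forall>i<j. m i = l i) \<longrightarrow> m j \<le> l j" for n
  proof (induction n)
    case 0
    then show ?case using assms by auto
  next
    case (Suc n)
    then obtain l where l: "l \<in> ?F" "\<And>j m. j < n \<Longrightarrow> m \<in> ?F \<Longrightarrow> (\<forall>i<j. m i = l i) \<Longrightarrow> m j \<le> l j"
      by blast
    let ?G = "?F \<inter> {m. \<forall>i<n. m i = l i}"
    have "closed {m. \<forall>i<n. m i = l i}"
    proof -
      have "closed {m::nat \<Rightarrow> real. m i = l i}" for i
        by (intro closed_Collect_eq continuous_intros continuous_on_product_coordinates)
      moreover have "{m. \<forall>i<n. m i = l i} = (\<Inter>i<n. {m. m i = l i})" by auto
      ultimately show ?thesis by auto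
    qed
    then have "compact ?G" by (intro compact_Int_closed compact_fibre)
    moreover have "l \<in> ?G" using l by auto
    moreover have "continuous_on ?G (\<lambda>m. m n)"
      by (rule continuous_on_subset[OF continuous_on_product_coordinates]) simp
    ultimately obtain m where m: "m \<in> ?G" "\<And>k. k \<in> ?G \<Longrightarrow> k n \<le> m n"
      using continuous_attains_sup[of ?G "\<lambda>m. m n"] by blast
    show ?case
    proof (intro bexI allI impI ballI)
      fix j k assume *: "j < Suc n" "k \<in> ?F" "\<forall>i<j. k i = m i"
      show "k j \<le> m j"
      proof (cases "j = n")
        case True
        then show ?thesis using * m by auto
      next
        case False
        then show ?thesis using * m(1) l(2)[of j k] by auto
      qed
    qed (use m in auto)
  qed
  obtain l where l: "l \<in> ?F" "\<And>j m. j < N \<Longrightarrow> m \<in> ?F \<Longrightarrow> (\<forall>i<j. m i = l i) \<Longrightarrow> m j \<le> l j"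
    using ex[of N] by blast
  have "optimal N v (supp l)"
    unfolding optimal_def
  proof
    assume "\<exists>d. (\<forall>i\<ge>N. d i = 0) \<and> sum d {..<N} = 0 \<and> comb N v d = (\<lambda>_. 0) \<and>
     (\<forall>i. i \<notin> supp l \<longrightarrow> d i \<ge> 0) \<and> lexpos d"
    then obtain d j where d: "\<And>i. i \<ge> N \<Longrightarrow> d i = 0" "sum d {..<N} = 0" "comb N v d = (\<lambda>_. 0)"
      "\<And>i. l i = 0 \<Longrightarrow> d i \<ge> 0" "d j > 0" "\<And>i. i < j \<Longrightarrow> d i = 0"
      unfolding lexpos_def supp_def by auto
    have nn: "l i \<ge> 0" for i using l(1) by (auto simp: weights_def)
    \<comment> \<open>The step size is found entry by entry: where \<open>d\<close> is negative,
      \<open>l\<close> is positive, and shrinking a step that works does no harm.\<close>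
    have ex_e: "\<exists>e>0. \<forall>i<n. l i + e * d i \<ge> 0" for n
    proof (induction n)
      case (Suc n)
      then obtain e where e: "e > 0" "\<forall>i<n. l i + e * d i \<ge> 0" by auto
      obtain e' where e': "e' > 0" "l n + e' * d n \<ge> 0"
      proof (cases "d n \<ge> 0")
        case True
        then show ?thesis using that[of 1] nn[of n] by auto
      next
        case False
        then have "l n > 0" using d(4)[of n] nn[of n] by fastforce
        then show ?thesis using that[of "l n / (- d n)"] False by (auto simp: field_simps)
      qed
      have "l i + min e e' * d i \<ge> 0" if "i < Suc n" for i
      proof -
        have "\<exists>f\<ge>min e e'. l i + f * d i \<ge> 0"
          using that e e' exI[of "\<lambda>f. f \<ge> min e e' \<and> l i + f * d i \<ge> 0" e]
            exI[of "\<lambda>f. f \<ge> min e e' \<and> l i + f * d i \<ge> 0" e']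
          by (cases "i = n") auto
        then obtain f where f: "f \<ge> min e e'" "l i + f * d i \<ge> 0" by auto
        show ?thesis
        proof (cases "d i \<ge> 0")
          case True
          then show ?thesis using nn[of i] e e' by (auto intro!: add_nonneg_nonneg mult_nonneg_nonneg)
        next
          case False
          then have "f * d i \<le> min e e' * d i" using f by (intro mult_right_mono_neg) auto
          then show ?thesis using f by linarith
        qed
      qed
      then show ?case using e e' by (intro exI[of _ "min e e'"]) auto
    qed (auto intro: exI[of _ 1])
    obtain e where e: "e > 0" "\<And>i. i < N \<Longrightarrow> l i + e * d i \<ge> 0"
      using ex_e[of N] by blast
    let ?m = "\<lambda>i. l i + e * d i"
    have "?m \<in> ?F"
    proof -
      have "comb N v ?m = comb N v l" using d(3) by (simp add: comb_add comb_scale)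
      moreover have "sum ?m {..<N} = sum l {..<N}"
        using d(2) by (simp add: sum.distrib flip: sum_distrib_left)
      moreover have "?m i \<ge> 0" for i using e(2) nn d(1) by (cases "i < N") auto
      ultimately show ?thesis using l(1) d(1) by (auto simp: weights_def)
    qed
    moreover have "j < N" using d(1,5) by (metis less_irrefl not_le)
    ultimately have "?m j \<le> l j" using l(2)[of j ?m] d(6) by auto
    then show False using d(5) e(1) by (simp add: mult_le_0_iff)
  qed
  then show ?thesis using l by auto
qed

section \<open>Integral and fractional parts of optimal weights\<close>

definition integral_fun :: "('a \<Rightarrow> real) \<Rightarrow> bool" where
  "integral_fun x \<longleftrightarrow> (\<forall>i. x i \<in> \<int>)"

definition opt_weights :: "nat \<Rightarrow> (nat \<Rightarrow> 'a \<Rightarrow> real) \<Rightarrow> real \<Rightarrow> (nat \<Rightarrow> real) set" where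
  "opt_weights N v t = {l \<in> weights N t. integral_fun (comb N v l) \<and> optimal N v (supp l)}"

text \<open>Existence and uniqueness of optimal weights make \<open>comb N v\<close> a bijection
  onto the points to be counted.\<close>

lemma card_opt_weights:
  "card {x \<in> comb N v ` weights N t. integral_fun x} = card (opt_weights N v t)"
proof -
  have "inj_on (comb N v) (opt_weights N v t)"
    unfolding opt_weights_def by (intro inj_onI) (auto intro: optimal_unique)
  moreover have "comb N v ` opt_weights N v t = {x \<in> comb N v ` weights N t. integral_fun x}"
  proof (intro equalityI subsetI)
    fix x assume "x \<in> {x \<in> comb N v ` weights N t. integral_fun x}"
    then obtain l0 where l0: "l0 \<in> weights N t" "x = comb N v l0" "integral_fun x" by auto
    then obtain l where "l \<in> weights N t" "comb N v l = x" "optimal N v (supp l)"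
      using optimal_exists[of l0 N t v] by blast
    then show "x \<in> comb N v ` opt_weights N v t"
      using l0(3) by (intro image_eqI[of _ _ l]) (auto simp: opt_weights_def)
  qed (auto simp: opt_weights_def)
  ultimately show ?thesis using card_image by fastforce
qed

text \<open>The lattice points of the half-open fundamental parallelepipeds of the cones over the
  simplices of the triangulation. The simplex of \<open>l\<close> has the vertex set
  \<open>insert 0 (supp l)\<close>, where only the apex coefficient can be zero.\<close>

definition frac_weights :: "nat \<Rightarrow> (nat \<Rightarrow> 'a \<Rightarrow> real) \<Rightarrow> (nat \<Rightarrow> real) set" where
  "frac_weights N v = {l. (\<forall>i. 0 \<le> l i \<and> l i \<le> 1) \<and> l 0 < 1 \<and> (\<forall>i\<ge>N. l i = 0) \<and>
     sum l {..<N} \<in> \<int> \<and> integral_fun (comb N v l) \<and> optimal N v (supp l)}"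

text \<open>The sum and the point of such weights are integral and bounded, hence take finitely many
  values, and by \<open>optimal_unique\<close> they determine the weights.\<close>

lemma finite_frac_weights:
  assumes E: "finite E" "\<And>i x. i < N \<Longrightarrow> x \<notin> E \<Longrightarrow> v i x = 0"
  shows "finite (frac_weights N v)"
proof -
  let ?f = "\<lambda>l. (sum l {..<N}, comb N v l)"
  define C where "C = (\<lambda>x. \<Sum>i<N. \<bar>v i x\<bar>)"
  let ?I = "\<lambda>c. {y::real. y \<in> \<int> \<and> \<bar>y\<bar> \<le> c}"
  let ?P = "{f. \<forall>x. (x \<in> E \<longrightarrow> f x \<in> (\<Union>x\<in>E. ?I (C x))) \<and> (x \<notin> E \<longrightarrow> f x = 0)}"
  have finI: "finite (?I c)" for c
    by (rule finite_abs_int_segment)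
  have "finite ?P"
    by (intro finite_set_of_finite_funs finite_UN_I E finI)
  then have "finite (?I N \<times> ?P)" using finI by blast
  moreover have "?f ` frac_weights N v \<subseteq> ?I N \<times> ?P"
  proof (clarify, intro conjI SigmaI CollectI allI impI)
    fix l assume l: "l \<in> frac_weights N v"
    then have b: "0 \<le> l i" "l i \<le> 1" for i by (auto simp: frac_weights_def)
    show "sum l {..<N} \<in> \<int>" using l by (simp add: frac_weights_def)
    have "sum l {..<N} \<le> (\<Sum>i<N. 1)" by (intro sum_mono b)
    moreover have "sum l {..<N} \<ge> 0" by (intro sum_nonneg b)
    ultimately show "\<bar>sum l {..<N}\<bar> \<le> N" by simp
    fix x
    show "comb N v l x = 0" if "x \<notin> E" using that E by (simp add: comb_def)
    assume x: "x \<in> E"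
    have "\<bar>comb N v l x\<bar> \<le> (\<Sum>i<N. \<bar>l i * v i x\<bar>)" unfolding comb_def by (rule sum_abs)
    also have "\<dots> \<le> C x" unfolding C_def
      by (intro sum_mono) (auto simp: abs_mult b intro: mult_left_le_one_le)
    finally show "comb N v l x \<in> (\<Union>x\<in>E. ?I (C x))"
      using l x by (auto simp: frac_weights_def integral_fun_def)
  qed
  ultimately have "finite (?f ` frac_weights N v)" by (rule finite_subset[rotated])
  moreover have "inj_on ?f (frac_weights N v)"
  proof (rule inj_onI)
    fix l m assume lm: "l \<in> frac_weights N v" "m \<in> frac_weights N v" "?f l = ?f m"
    then have "l \<in> weights N (sum l {..<N})" "m \<in> weights N (sum l {..<N})"
      by (auto simp: frac_weights_def weights_def)
    then show "l = m"
      using lm optimal_unique[of l N "sum l {..<N}" m v] by (simp add: frac_weights_def)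
  qed
  ultimately show ?thesis using finite_imageD[of ?f "frac_weights N v"] by blast
qed

text \<open>
  Rounding the coefficient of the apex down and the others up gives fractional parts in
  \<open>[0, 1)\<close> and \<open>(0, 1]\<close>, respectively.  Hence their sum is less than the number of vertices of
  the simplex, which makes the count below valid down to \<open>t = 0\<close>.
\<close>

definition nat_part :: "(nat \<Rightarrow> real) \<Rightarrow> nat \<Rightarrow> nat" where
  "nat_part l i = (if i = 0 then nat \<lfloor>l i\<rfloor> else nat (\<lceil>l i\<rceil> - 1))"

definition nat_weights :: "nat \<Rightarrow> (nat \<Rightarrow> real) \<Rightarrow> real \<Rightarrow> (nat \<Rightarrow> nat) set" where
  "nat_weights N l t = {m. (\<forall>i. i \<notin> insert 0 (supp l) \<longrightarrow> m i = 0) \<and>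
     real (sum m (insert 0 (supp l))) + sum l {..<N} = t}"

text \<open>Integral parts do not affect integrality of the point, as the vertices are integral.
  They change the support at most at the apex, so \<open>optimal_insert_0\<close> transfers
  optimality in both directions.\<close>

lemma opt_weights_bij:
  assumes N: "N > 0" and v: "\<And>i x. i < N \<Longrightarrow> v i x \<in> \<int>" and t: "t \<in> \<int>"
  shows "bij_betw (\<lambda>(l, m). \<lambda>i. l i + real (m i))
    (SIGMA l:frac_weights N v. nat_weights N l t) (opt_weights N v t)"
proof (rule bij_betw_byWitness[where f' = "\<lambda>l. (\<lambda>i. l i - real (nat_part l i), nat_part l)"])
  let ?S = "SIGMA l:frac_weights N v. nat_weights N l t"
  have supp_sub: "insert 0 (supp l) \<subseteq> {..<N}" if "l \<in> frac_weights N v" for l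
    using that N by (auto simp: frac_weights_def supp_def) (metis not_le)
  have sum_eq: "sum m {..<N} = sum m (insert 0 (supp l))"
    if "l \<in> frac_weights N v" "m \<in> nat_weights N l t" for l m
    using that supp_sub by (intro sum.mono_neutral_right) (auto simp: nat_weights_def)
  have comb_int: "comb N v (\<lambda>i. real (m i)) x \<in> \<int>" for m x
    unfolding comb_def by (intro Ints_sum Ints_mult v) auto
  show "\<forall>p\<in>?S. (\<lambda>l. (\<lambda>i. l i - real (nat_part l i), nat_part l)) (case p of (l, m) \<Rightarrow> \<lambda>i. l i + real (m i)) = p"
  proof (clarify, goal_cases)
    case (1 l m)
    have "nat_part (\<lambda>i. l i + real (m i)) i = m i" for i
    proof -
      have b: "0 \<le> l i" "l i \<le> 1" "l 0 < 1" using 1 by (auto simp: frac_weights_def)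
      have f: "\<lfloor>l i\<rfloor> = 0" if "i = 0" using b that by (auto simp: floor_eq_iff)
      have c: "\<lceil>l i\<rceil> = 1" if "l i \<noteq> 0" using b that by (auto simp: ceiling_eq_iff)
      have "\<lceil>l i + real (m i)\<rceil> = \<lceil>l i\<rceil> + int (m i)" "\<lfloor>l i + real (m i)\<rfloor> = \<lfloor>l i\<rfloor> + int (m i)"
        by (metis ceiling_add_of_int of_int_of_nat_eq, metis floor_add_int of_int_of_nat_eq add.commute)
      then show ?thesis
        using 1 f c by (cases "l i = 0") (auto simp: nat_part_def nat_weights_def supp_def)
    qed
    then show ?case by auto
  qed
  show "\<forall>l\<in>opt_weights N v t. (case (\<lambda>i. l i - real (nat_part l i), nat_part l) of (l, m) \<Rightarrow> \<lambda>i. l i + real (m i)) = l"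
    by auto
  show "(\<lambda>(l, m). \<lambda>i. l i + real (m i)) ` ?S \<subseteq> opt_weights N v t"
  proof
    fix k assume "k \<in> (\<lambda>(l, m). \<lambda>i. l i + real (m i)) ` ?S"
    then obtain l m where 1: "l \<in> frac_weights N v" "m \<in> nat_weights N l t"
      and k: "k = (\<lambda>i. l i + real (m i))" by auto
    let ?k = "\<lambda>i. l i + real (m i)"
    have l: "\<And>i. 0 \<le> l i" "\<And>i. i \<ge> N \<Longrightarrow> l i = 0" "integral_fun (comb N v l)" "optimal N v (supp l)"
      using 1(1) by (auto simp: frac_weights_def)
    have m: "\<And>i. i \<notin> insert 0 (supp l) \<Longrightarrow> m i = 0" "real (sum m (insert 0 (supp l))) + sum l {..<N} = t"
      using 1(2) by (auto simp: nat_weights_def)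
    have m0: "m i = 0" if "i \<ge> N" for i using that m(1)[of i] supp_sub[OF 1(1)] by fastforce
    have "sum ?k {..<N} = t"
      using sum_eq[OF 1] m(2) by (simp add: sum.distrib flip: of_nat_sum)
    moreover have "integral_fun (comb N v ?k)"
      using l(3) comb_int by (auto simp: comb_add integral_fun_def)
    moreover have "optimal N v (supp ?k)"
    proof -
      have "insert 0 (supp ?k) = insert 0 (supp l)"
        using m(1) l(1) by (auto simp: supp_def add_nonneg_eq_0_iff)
      then show ?thesis using l(4) by (metis optimal_insert_0)
    qed
    ultimately show "k \<in> opt_weights N v t" using l m0 unfolding k by (auto simp: opt_weights_def weights_def)
  qed
  show "(\<lambda>l. (\<lambda>i. l i - real (nat_part l i), nat_part l)) ` opt_weights N v t \<subseteq> ?S"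
  proof (rule image_subsetI)
    fix l assume 1: "l \<in> opt_weights N v t"
    let ?k = "\<lambda>i. l i - real (nat_part l i)"
    have l: "\<And>i. 0 \<le> l i" "\<And>i. i \<ge> N \<Longrightarrow> l i = 0" "integral_fun (comb N v l)" "optimal N v (supp l)"
      "sum l {..<N} = t"
      using 1 by (auto simp: opt_weights_def weights_def)
    have k0: "0 \<le> ?k 0" "?k 0 < 1" using l(1)[of 0] by (auto simp: nat_part_def) linarith+
    have ki: "0 < ?k i \<and> ?k i \<le> 1" if "i \<noteq> 0" "l i \<noteq> 0" for i
    proof -
      have "l i > 0" using that l(1)[of i] by simp
      then have "\<lceil>l i\<rceil> \<ge> 1" by simp
      then show ?thesis using that by (auto simp: nat_part_def) linarith+
    qed
    have np0: "nat_part l i = 0" if "l i = 0" for i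
      using that by (cases "i = 0") (simp_all add: nat_part_def)
    have ki0: "?k i = 0" if "l i = 0" for i using that np0 by simp
    have bounds: "0 \<le> ?k i \<and> ?k i \<le> 1" for i
    proof (cases "i = 0 \<or> l i = 0")
      case True
      then show ?thesis using k0 ki0[of i] by (elim disjE) simp_all
    next
      case False
      then show ?thesis using ki[of i] by simp
    qed
    have su: "insert 0 (supp ?k) = insert 0 (supp l)"
      using ki ki0 by (fastforce simp: supp_def)
    have frac: "?k \<in> frac_weights N v"
    proof -
      have "sum ?k {..<N} \<in> \<int>" using t l(5) by (auto simp: sum_subtractf intro: Ints_diff)
      moreover have "integral_fun (comb N v ?k)"
        using l(3) comb_int by (auto simp: comb_diff integral_fun_def)
      moreover have "optimal N v (supp ?k)" using su l(4) by (metis optimal_insert_0)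
      ultimately show ?thesis using bounds k0 l(2) ki0 by (auto simp: frac_weights_def)
    qed
    moreover have "nat_part l \<in> nat_weights N ?k t"
    proof -
      have "sum (nat_part l) {..<N} = sum (nat_part l) (insert 0 (supp ?k))"
      proof (rule sum.mono_neutral_right)
        show "\<forall>i\<in>{..<N} - insert 0 (supp ?k). nat_part l i = 0"
          unfolding su using np0 by (auto simp: supp_def)
      qed (use supp_sub[OF frac] in auto)
      moreover have "sum ?k {..<N} = t - real (sum (nat_part l) {..<N})"
        using l(5) by (simp add: sum_subtractf)
      ultimately have "real (sum (nat_part l) (insert 0 (supp ?k))) + sum ?k {..<N} = t"
        by linarith
      moreover have "\<forall>i. i \<notin> insert 0 (supp ?k) \<longrightarrow> nat_part l i = 0"
        unfolding su using np0 by (auto simp: supp_def)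
      ultimately show ?thesis unfolding nat_weights_def by blast
    qed
    ultimately show "(\<lambda>i. l i - real (nat_part l i), nat_part l) \<in> ?S" by simp
  qed
qed

text \<open>With \<open>h\<close> the sum of \<open>l\<close> and \<open>d + 1\<close> vertices,
  \<open>t - h\<close> is split into \<open>d + 1\<close> parts. For \<open>t < h\<close> this is
  impossible, and the binomial coefficient vanishes because \<open>h \<le> d\<close> makes
  \<open>t + (d - h)\<close> less than \<open>d\<close>.\<close>

lemma card_nat_weights:
  assumes l: "l \<in> frac_weights N v"
  shows "\<exists>h d. h \<le> d \<and> (\<forall>t. finite (nat_weights N l (real t)) \<and>
    card (nat_weights N l (real t)) = (t + (d - h)) choose d)"
proof -
  let ?A = "supp l - {0}"
  let ?d = "card ?A"
  have b: "0 \<le> l i" "l i \<le> 1" "l 0 < 1" "i \<ge> N \<Longrightarrow> l i = 0" "sum l {..<N} \<in> \<int>" for i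
    using l by (auto simp: frac_weights_def)
  have "supp l \<subseteq> {..<N}" using b(4) by (auto simp: supp_def) (metis not_le)
  then have finA: "finite ?A" "finite (supp l)" using finite_subset by auto
  have cardI: "card (insert 0 (supp l)) = Suc ?d"
    using finA by (metis card.insert_remove)
  have "sum l {..<N} = sum l (supp l)"
    using \<open>supp l \<subseteq> {..<N}\<close> by (intro sum.mono_neutral_right) (auto simp: supp_def)
  also have "\<dots> = sum l (insert 0 (supp l))"
    using finA by (intro sum.mono_neutral_left) (auto simp: supp_def)
  also have "\<dots> = l 0 + sum l ?A"
    using finA by (simp add: sum.insert_remove)
  also have "\<dots> < 1 + (\<Sum>i\<in>?A. 1)"
    by (intro add_less_le_mono sum_mono b)
  finally have lt: "sum l {..<N} < real (Suc ?d)" by simp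
  have "sum l {..<N} \<ge> 0" by (intro sum_nonneg b)
  then obtain h where h: "sum l {..<N} = real h"
    using b(5) by (metis Ints_cases nonneg_int_cases of_int_0_le_iff of_int_of_nat_eq)
  have hd: "h \<le> ?d" using lt h by simp
  have "finite (nat_weights N l (real t)) \<and> card (nat_weights N l (real t)) = (t + (?d - h)) choose ?d" for t
  proof (cases "h \<le> t")
    case True
    have "nat_weights N l (real t) =
        {m. (\<forall>i. i \<notin> insert 0 (supp l) \<longrightarrow> m i = 0) \<and> sum m (insert 0 (supp l)) = t - h}"
      unfolding nat_weights_def h using True by (auto simp: of_nat_diff simp flip: of_nat_sum of_nat_add)
    then show ?thesis
      using weak_compositions[of "insert 0 (supp l)" "t - h"] finA cardI True hd by simp
  next
    case False
    have "nat_weights N l (real t) = {}"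
      unfolding nat_weights_def h using False
      by (auto simp flip: of_nat_sum of_nat_add)
    then show ?thesis using False hd by (simp add: binomial_eq_0)
  qed
  then show ?thesis using hd by blast
qed

lemma binomial_poly: "\<exists>p :: real poly. \<forall>t. poly p (real t) = real ((t + c) choose d)"
proof (intro exI allI)
  fix t
  show "poly (smult (1 / fact d) (\<Prod>i<d. [:real c - real i, 1:])) (real t) = real ((t + c) choose d)"
    by (simp add: binomial_gbinomial gbinomial_prod_rev poly_prod atLeast0LessThan algebra_simps)
qed

theorem ehrhart_weights:
  fixes v :: "nat \<Rightarrow> 'a \<Rightarrow> real"
  assumes N: "N > 0" and E: "finite E" "\<And>i x. i < N \<Longrightarrow> x \<notin> E \<Longrightarrow> v i x = 0"
    and v: "\<And>i x. i < N \<Longrightarrow> v i x \<in> \<int>"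
  shows "\<exists>p :: real poly. \<forall>t::nat. poly p (real t) = real (card {x \<in> comb N v ` weights N (real t). integral_fun x})"
proof -
  let ?F = "frac_weights N v"
  have finF: "finite ?F" by (rule finite_frac_weights[OF E])
  have "\<exists>p :: real poly. \<forall>t::nat. finite (nat_weights N l (real t)) \<and>
     poly p (real t) = real (card (nat_weights N l (real t)))" if l: "l \<in> ?F" for l
  proof -
    obtain h d where hd: "\<And>t::nat. finite (nat_weights N l (real t))"
      "\<And>t::nat. card (nat_weights N l (real t)) = (t + (d - h)) choose d"
      using card_nat_weights[OF l] by blast
    obtain p :: "real poly" where "\<And>t::nat. poly p (real t) = real ((t + (d - h)) choose d)"
      using binomial_poly[of "d - h" d] by blast
    then show ?thesis using hd by (intro exI[of _ p]) simp
  qed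
  then have "\<exists>p :: (nat \<Rightarrow> real) \<Rightarrow> real poly. \<forall>l\<in>?F. \<forall>t::nat. finite (nat_weights N l (real t)) \<and>
     poly (p l) (real t) = real (card (nat_weights N l (real t)))"
    by (intro bchoice) blast
  then obtain p :: "(nat \<Rightarrow> real) \<Rightarrow> real poly"
    where p: "\<And>l t. l \<in> ?F \<Longrightarrow> finite (nat_weights N l (real t))"
    "\<And>l t. l \<in> ?F \<Longrightarrow> poly (p l) (real t) = real (card (nat_weights N l (real t)))"
    by blast
  have "poly (\<Sum>l\<in>?F. p l) (real t) = real (card {x \<in> comb N v ` weights N (real t). integral_fun x})" for t :: nat
  proof -
    have "card (opt_weights N v (real t)) = card (SIGMA l:?F. nat_weights N l (real t))"
      using bij_betw_same_card[OF opt_weights_bij[of N v "real t"]] N v by simp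
    also have "\<dots> = (\<Sum>l\<in>?F. card (nat_weights N l (real t)))"
      using finF p(1) by (intro card_SigmaI) auto
    finally show ?thesis
      using p(2) by (simp add: card_opt_weights poly_sum)
  qed
  then show ?thesis by blast
qed

section \<open>Points of a dilated convex hull as weighted sums\<close>

lemma sum_fun_apply: "(\<Sum>a\<in>A. f a) x = (\<Sum>a\<in>A. f a x)"
  for f :: "'b \<Rightarrow> 'c \<Rightarrow> 'd::comm_monoid_add"
  by (induction A rule: infinite_finite_induct) auto

definition mix :: "'b set \<Rightarrow> ('b \<Rightarrow> 'a \<Rightarrow> real) \<Rightarrow> real \<Rightarrow> ('b \<Rightarrow> real) \<Rightarrow> ('a \<Rightarrow> real) \<Rightarrow> bool" where
  "mix I f t a x \<longleftrightarrow> (\<forall>i\<in>I. 0 \<le> a i) \<and> sum a I = t \<and> (\<forall>y. x y = (\<Sum>i\<in>I. a i * f i y))"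

text \<open>Injectivity lets the weights be indexed by \<open>I\<close> instead of the points
  \<open>f i\<close>. At \<open>t = 0\<close> they cannot be rescaled; there all weights vanish, and
  nonemptiness of the hull yields the origin.\<close>

lemma scaled_convex_hull:
  fixes f :: "'b \<Rightarrow> 'a \<Rightarrow> real"
  assumes I: "finite I" "I \<noteq> {}" and inj: "inj_on f I" and t: "t \<ge> 0"
  shows "x \<in> (\<lambda>y. t *\<^sub>R y) ` (convex hull (f ` I)) \<longleftrightarrow> (\<exists>a. mix I f t a x)"
proof
  assume "x \<in> (\<lambda>y. t *\<^sub>R y) ` (convex hull (f ` I))"
  then obtain y where y: "y \<in> convex hull (f ` I)" "x = t *\<^sub>R y" by (rule imageE)
  then obtain u where u: "\<forall>w\<in>f ` I. 0 \<le> u w" "sum u (f ` I) = 1" "(\<Sum>w\<in>f ` I. u w *\<^sub>R w) = y"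
    using I by (auto simp: convex_hull_finite)
  have "(\<Sum>i\<in>I. t * u (f i)) = t * sum u (f ` I)"
    using inj by (simp add: sum.reindex sum_distrib_left)
  moreover have "x z = (\<Sum>i\<in>I. (t * u (f i)) * f i z)" for z
  proof -
    have "x z = t * (\<Sum>w\<in>f ` I. u w * w z)"
      by (simp add: y(2) u(3)[symmetric] scaleR_fun_def sum_fun_apply)
    then show ?thesis
      using inj by (simp add: sum.reindex sum_distrib_left mult.assoc)
  qed
  ultimately have "mix I f t (\<lambda>i. t * u (f i)) x"
    using u(1,2) t by (simp add: mix_def)
  then show "\<exists>a. mix I f t a x" by (intro exI)
next
  assume "\<exists>a. mix I f t a x"
  then obtain a where "mix I f t a x" by (rule exE)
  then have a: "\<And>i. i \<in> I \<Longrightarrow> 0 \<le> a i" "sum a I = t" "\<And>y. x y = (\<Sum>i\<in>I. a i * f i y)"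
    by (simp_all add: mix_def)
  show "x \<in> (\<lambda>y. t *\<^sub>R y) ` (convex hull (f ` I))"
  proof (cases "t = 0")
    case True
    then have "a i = 0" if "i \<in> I" for i
      using sum_nonneg_eq_0_iff[of I a] a(1,2) that I by simp
    then have "x = 0" using a(3) by (simp add: fun_eq_iff)
    moreover obtain y where "y \<in> convex hull (f ` I)" using I by fastforce
    ultimately show ?thesis using True by (intro image_eqI[of _ _ y]) simp_all
  next
    case False
    let ?u = "\<lambda>w. a (inv_into I f w) / t"
    let ?y = "\<Sum>w\<in>f ` I. ?u w *\<^sub>R w"
    have "sum ?u (f ` I) = 1"
      using inj a(2) False by (simp add: sum.reindex sum_divide_distrib[symmetric])
    moreover have "\<forall>w\<in>f ` I. 0 \<le> ?u w"
      using inj a(1) t by simp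
    ultimately have "?y \<in> convex hull (f ` I)"
      unfolding convex_hull_finite[OF finite_imageI[OF I(1)]]
      by (intro CollectI exI[of _ ?u] conjI refl)
    moreover have "x = t *\<^sub>R ?y"
    proof
      fix z
      have "(t *\<^sub>R ?y) z = t * (\<Sum>i\<in>I. (a i / t) * f i z)"
        using inj by (simp add: scaleR_fun_def sum_fun_apply sum.reindex)
      also have "\<dots> = x z"
        using False a(3) by (simp add: sum_distrib_left)
      finally show "x z = (t *\<^sub>R ?y) z" by simp
    qed
    ultimately show ?thesis by (intro image_eqI)
  qed
qed

theorem ehrhart_lattice_polytope:
  fixes V :: "('a \<Rightarrow> real) set"
  assumes V: "finite V" "V \<noteq> {}" and E: "finite E" "\<And>v x. v \<in> V \<Longrightarrow> x \<notin> E \<Longrightarrow> v x = 0"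
    and int: "\<And>v x. v \<in> V \<Longrightarrow> v x \<in> \<int>"
  shows "\<exists>p :: real poly. \<forall>t::nat. poly p (real t) = real (card (lattice_points (convex hull V) t))"
proof -
  define N where "N = card V"
  obtain v where v: "bij_betw v {..<N} V"
    using ex_bij_betw_nat_finite[OF V(1)] unfolding N_def atLeast0LessThan by auto
  have inV: "v i \<in> V" if "i < N" for i using v that by (auto simp: bij_betw_def)
  have N: "N > 0" using V by (simp add: N_def card_gt_0_iff)
  have Vv: "V = v ` {..<N}" and inj: "inj_on v {..<N}" using v by (auto simp: bij_betw_def)
  have ne: "{..<N} \<noteq> {}" using N by auto
  have "lattice_points (convex hull V) t = {x \<in> comb N v ` weights N (real t). integral_fun x}" for t
  proof -
    have "x \<in> (\<lambda>y. real t *\<^sub>R y) ` (convex hull V) \<longleftrightarrow> x \<in> comb N v ` weights N (real t)" for x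
      unfolding Vv scaled_convex_hull[OF finite_lessThan ne inj of_nat_0_le_iff]
    proof
      assume "\<exists>a. mix {..<N} v (real t) a x"
      then obtain a where a: "mix {..<N} v (real t) a x" by (rule exE)
      let ?l = "\<lambda>i. if i < N then a i else 0"
      have "x = comb N v ?l" using a by (simp add: mix_def comb_def fun_eq_iff)
      moreover have "?l \<in> weights N (real t)" using a by (simp add: mix_def weights_def)
      ultimately show "x \<in> comb N v ` weights N (real t)" by (rule image_eqI)
    next
      assume "x \<in> comb N v ` weights N (real t)"
      then obtain l where l: "x = comb N v l" "l \<in> weights N (real t)" by (rule imageE)
      then have "mix {..<N} v (real t) l x" by (simp add: mix_def comb_def weights_def)
      then show "\<exists>a. mix {..<N} v (real t) a x" by (intro exI)
    qed
    then show ?thesis by (simp add: lattice_points_def integral_fun_def)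
  qed
  then show ?thesis
    using ehrhart_weights[OF N E(1), of v] E(2) int inV by simp
qed


section \<open>Sums of products of binomial coefficients\<close>

text \<open>For \<open>a = k - 1\<close> and \<open>b = n - k - 1\<close> this is the value of
  \<open>D_{k,n}\<close> at \<open>t - 1\<close>; the strict bound on \<open>s\<close> produces the
  shift in the theorem and the value 0 at \<open>t = 0\<close>.\<close>

definition diag_sum :: "nat \<Rightarrow> nat \<Rightarrow> nat \<Rightarrow> nat" where
  "diag_sum a b t = (\<Sum>s<t. ((s + a) choose a) * ((s + b) choose b))"

lemma diag_sum_0: "diag_sum 0 b t = (t + b) choose (Suc b)"
  unfolding diag_sum_def by (induction t) (auto)

lemma binomial_shift: "real (Suc a) * real ((t + a) choose (Suc a)) = real t * real ((t + a) choose a)"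
proof (cases t)
  case (Suc u)
  have "Suc a * ((t + a) choose (Suc a)) = t * ((t + a) choose a)"
    using Suc_times_binomial_add[of a u] Suc by (simp add: add.commute)
  then show ?thesis by (metis of_nat_mult)
qed simp

text \<open>The increments in \<open>t\<close> of both sides agree: expressed through
  \<open>u\<close> and \<open>w\<close>, they satisfy the rational identity \<open>key\<close>. All
  terms on the right come with a plus sign, which \<open>diag_sum_poly\<close> needs for its
  induction on \<open>a\<close>.\<close>

lemma diag_sum_rec:
  "real (a + b + 2) * real (diag_sum (Suc a) b t) =
     real (b + 1) * real ((t + a) choose (Suc a)) * real ((t + b) choose (Suc b))
     + real (a + 1) * real (diag_sum a b t)"
proof (induction t)
  case 0
  then show ?case by (simp add: diag_sum_def)
next
  case (Suc t)
  define u w where "u = real ((t + a) choose a)" and "w = real ((t + b) choose b)"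
  have ua: "real ((t + a) choose (Suc a)) = real t * u / real (Suc a)"
    using binomial_shift[of a t] by (simp add: u_def field_simps del: of_nat_Suc)
  have wb: "real ((t + b) choose (Suc b)) = real t * w / real (Suc b)"
    using binomial_shift[of b t] by (simp add: w_def field_simps del: of_nat_Suc)
  have ua': "real ((Suc t + a) choose (Suc a)) = u + real t * u / real (Suc a)"
    using ua by (simp add: u_def)
  have wb': "real ((Suc t + b) choose (Suc b)) = w + real t * w / real (Suc b)"
    using wb by (simp add: w_def)
  have S1: "real (diag_sum (Suc a) b (Suc t))
      = real (diag_sum (Suc a) b t) + (u + real t * u / real (Suc a)) * w"
    using ua' by (simp add: diag_sum_def w_def)
  have S2: "real (diag_sum a b (Suc t)) = real (diag_sum a b t) + u * w"
    by (simp add: diag_sum_def w_def u_def)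
  have key: "(x + y) * ((u + s * u / x) * w)
      = y * ((u + s * u / x) * (w + s * w / y)) - y * ((s * u / x) * (s * w / y)) + x * (u * w)"
    if "x > 0" "y > 0" for x y s :: real
    using that by (simp add: field_simps)
  define x y where "x = real (Suc a)" and "y = real (Suc b)"
  have xy: "real (a + b + 2) = x + y" "real (a + 1) = x" "real (b + 1) = y" "x > 0" "y > 0"
    by (simp_all add: x_def y_def)
  show ?case
    using Suc.IH key[OF xy(4,5), of "real t"]
    unfolding S1 S2 ua wb ua' wb' xy(1-3) x_def[symmetric] y_def[symmetric]
      distrib_left[of "x + y" "real (diag_sum (Suc a) b t)"]
      distrib_left[of x "real (diag_sum a b t)"] mult.assoc[of y]
    by linarith
qed

section \<open>Rising factorials and positivity of coefficients\<close>

text \<open>Its coefficients are the unsigned Stirling numbers of the first kind; up to a factorial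
  it is a binomial coefficient seen as a polynomial in its upper entry.\<close>

definition rising :: "nat \<Rightarrow> real poly" where
  "rising d = (\<Prod>j<d. [:real j, 1:])"

lemma rising_Suc: "rising (Suc d) = smult (real d) (rising d) + pCons 0 (rising d)"
  by (simp add: rising_def mult.commute[of _ "[:_, _:]"])

lemma poly_rising: "poly (rising (Suc a)) (real t) = fact (Suc a) * real ((t + a) choose (Suc a))"
proof -
  have "poly (rising (Suc a)) (real t) = pochhammer (real t) (Suc a)"
    by (simp add: rising_def pochhammer_prod poly_prod atLeast0LessThan add.commute del: prod.lessThan_Suc)
  also have "\<dots> = fact (Suc a) * (real (t + a) gchoose (Suc a))"
    by (simp add: gbinomial_pochhammer' del: pochhammer_Suc fact_Suc)
  finally show ?thesis
    by (simp only: binomial_gbinomial)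
qed

lemma degree_rising: "degree (rising d) = d"
  unfolding rising_def by (subst degree_prod_eq_sum_degree) auto

lemma lead_coeff_rising: "coeff (rising d) d = 1"
proof -
  have "lead_coeff (rising d) = 1"
    unfolding rising_def lead_coeff_prod by simp
  then show ?thesis by (simp add: degree_rising)
qed

lemma coeff_rising_nonneg: "coeff (rising d) i \<ge> 0"
proof (induction d arbitrary: i)
  case (Suc d)
  then show ?case
    by (cases i) (auto simp: rising_Suc)
qed (simp add: rising_def)

lemma coeff_rising_pos: "1 \<le> i \<Longrightarrow> i \<le> d \<Longrightarrow> coeff (rising d) i > 0"
proof (induction d arbitrary: i)
  case (Suc d)
  show ?case
  proof (cases "i = Suc d")
    case True
    then show ?thesis using lead_coeff_rising[of "Suc d"] by simp
  next
    case False
    then have "coeff (rising d) i > 0" "d > 0" using Suc by auto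
    then show ?thesis
      using coeff_rising_nonneg[of d "i - 1"] Suc.prems
      by (cases i) (auto simp: rising_Suc intro: add_pos_nonneg)
  qed
qed simp

text \<open>The constant term is left out, being 0 because the sum at \<open>t = 0\<close> is empty.
  By \<open>diag_sum_rec\<close>, the next polynomial combines a product of rising factorials and
  the previous polynomial with positive factors.\<close>

lemma diag_sum_poly:
  "\<exists>q :: real poly. (\<forall>t. poly q (real t) = real (diag_sum a b t)) \<and> degree q \<le> a + b + 1 \<and>
     (\<forall>i. 1 \<le> i \<and> i \<le> a + b + 1 \<longrightarrow> coeff q i > 0)"
proof (induction a)
  case 0
  show ?case
  proof (intro exI conjI allI impI)
    let ?q = "smult (1 / fact (Suc b)) (rising (Suc b))"
    show "poly ?q (real t) = real (diag_sum 0 b t)" for t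
      by (simp add: poly_rising diag_sum_0 del: fact_Suc)
    show "degree ?q \<le> 0 + b + 1" by (simp add: degree_rising)
    show "coeff ?q i > 0" if "1 \<le> i \<and> i \<le> 0 + b + 1" for i
      using that coeff_rising_pos[of i "Suc b"] by (simp del: fact_Suc)
  qed
next
  case (Suc a)
  then obtain q where q: "\<And>t. poly q (real t) = real (diag_sum a b t)" "degree q \<le> a + b + 1"
    "\<And>i. 1 \<le> i \<Longrightarrow> i \<le> a + b + 1 \<Longrightarrow> coeff q i > 0" by auto
  define R where "R = rising (Suc a) * rising (Suc b)"
  define c where "c = real (b + 1) / (fact (Suc a) * fact (Suc b))"
  have c: "c > 0" by (simp add: c_def del: fact_Suc)
  have Rnn: "coeff R i \<ge> 0" for i
    unfolding R_def coeff_mult by (intro sum_nonneg mult_nonneg_nonneg coeff_rising_nonneg)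
  have Rdeg: "degree R = a + b + 2"
    unfolding R_def using lead_coeff_rising[of "Suc a"] lead_coeff_rising[of "Suc b"]
    by (subst degree_mult_eq) (auto simp: degree_rising)
  have Rlead: "coeff R (a + b + 2) = 1"
    using lead_coeff_mult[of "rising (Suc a)" "rising (Suc b)"]
    by (simp add: R_def[symmetric] Rdeg degree_rising lead_coeff_rising)
  let ?p = "smult (1 / real (a + b + 2)) (smult c R + smult (real (a + 1)) q)"
  show ?case
  proof (intro exI conjI allI impI)
    show "poly ?p (real t) = real (diag_sum (Suc a) b t)" for t
    proof -
      have "poly (smult c R + smult (real (a + 1)) q) (real t)
          = real (a + b + 2) * real (diag_sum (Suc a) b t)"
        unfolding diag_sum_rec by (simp add: R_def poly_rising q c_def del: fact_Suc)
      then show ?thesis by (simp del: of_nat_Suc of_nat_add)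
    qed
    have "degree (smult c R + smult (real (a + 1)) q) \<le> a + b + 2"
      using q(2) Rdeg c by (intro degree_add_le) auto
    then show "degree ?p \<le> Suc a + b + 1" by simp
    show "coeff ?p i > 0" if i: "1 \<le> i \<and> i \<le> Suc a + b + 1" for i
    \<comment> \<open>The new top coefficient comes from \<open>R\<close> alone; the lower ones are
      positive already through \<open>q\<close>.\<close>
    proof (cases "i = a + b + 2")
      case True
      moreover have "coeff q (a + b + 2) = 0" using q(2) by (intro coeff_eq_0) simp
      ultimately show ?thesis using c Rlead by simp
    next
      case False
      then have "coeff q i > 0" using i q(3) by auto
      then show ?thesis using c Rnn[of i] by (simp add: add_nonneg_pos)
    qed
  qed
qed


section \<open>Dilates of convex hulls of indicators\<close>

text \<open>Dilates are handled through weights on the sets, so that Minkowski sums and scalings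
  become sums and multiples of weights.\<close>

definition in_dilate :: "'a set set \<Rightarrow> real \<Rightarrow> ('a \<Rightarrow> real) \<Rightarrow> bool" where
  "in_dilate Bs t x \<longleftrightarrow> (\<exists>a. mix Bs indicator t a x)"

lemma in_dilateI:
  assumes "\<And>B. B \<in> Bs \<Longrightarrow> 0 \<le> a B" "sum a Bs = t" "\<And>i. x i = (\<Sum>B\<in>Bs. a B * indicator B i)"
  shows "in_dilate Bs t x"
  unfolding in_dilate_def mix_def using assms by blast

lemma in_dilateE:
  assumes "in_dilate Bs t x"
  obtains a where "\<And>B. B \<in> Bs \<Longrightarrow> 0 \<le> a B" "sum a Bs = t" "\<And>i. x i = (\<Sum>B\<in>Bs. a B * indicator B i)"
  using assms unfolding in_dilate_def mix_def by metis

lemma lattice_points_matroid: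
  assumes "finite (bases M)" "bases M \<noteq> {}"
  shows "lattice_points (matroid_polytope M) t = {x. in_dilate (bases M) (real t) x \<and> integral_fun x}"
proof -
  have "inj_on (\<lambda>B. indicator B :: 'a \<Rightarrow> real) (bases M)"
    by (intro inj_onI set_eqI) (metis indicator_eq_1_iff)
  then have "x \<in> (\<lambda>y. real t *\<^sub>R y) ` matroid_polytope M \<longleftrightarrow> in_dilate (bases M) (real t) x" for x
    unfolding matroid_polytope_def in_dilate_def using assms by (intro scaled_convex_hull) auto
  then show ?thesis by (simp add: lattice_points_def integral_fun_def)
qed

lemma in_dilate_single:
  assumes "finite Bs" "B \<in> Bs"
  shows "in_dilate Bs 1 (indicator B)"
proof (rule in_dilateI[where a = "\<lambda>C. if C = B then 1 else 0"])
  fix i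
  have "(\<Sum>C\<in>Bs. (if C = B then 1 else 0) * indicator C i :: real) = (\<Sum>C\<in>Bs. if C = B then indicator B i else 0)"
    by (intro sum.cong) auto
  then show "indicator B i = (\<Sum>C\<in>Bs. (if C = B then 1 else 0) * indicator C i :: real)"
    using assms by simp
qed (use assms in auto)

lemma in_dilate_zero: "in_dilate Bs 0 (\<lambda>i. 0)"
  by (intro in_dilateI[where a = "\<lambda>_. 0"]) auto

lemma in_dilate_add:
  assumes "in_dilate Bs s x" "in_dilate Bs t y"
  shows "in_dilate Bs (s + t) (\<lambda>i. x i + y i)"
proof -
  obtain a where a: "\<And>B. B \<in> Bs \<Longrightarrow> 0 \<le> a B" "sum a Bs = s" "\<And>i. x i = (\<Sum>B\<in>Bs. a B * indicator B i)"
    using assms(1) by (rule in_dilateE) blast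
  obtain b where b: "\<And>B. B \<in> Bs \<Longrightarrow> 0 \<le> b B" "sum b Bs = t" "\<And>i. y i = (\<Sum>B\<in>Bs. b B * indicator B i)"
    using assms(2) by (rule in_dilateE) blast
  show ?thesis
    by (intro in_dilateI[where a = "\<lambda>B. a B + b B"]) (simp_all add: a b sum.distrib algebra_simps)
qed

lemma in_dilate_scale:
  assumes "in_dilate Bs t x" "c \<ge> 0"
  shows "in_dilate Bs (c * t) (\<lambda>i. c * x i)"
proof -
  obtain a where a: "\<And>B. B \<in> Bs \<Longrightarrow> 0 \<le> a B" "sum a Bs = t" "\<And>i. x i = (\<Sum>B\<in>Bs. a B * indicator B i)"
    using assms(1) by (rule in_dilateE) blast
  have "sum (\<lambda>B. c * a B) Bs = c * t" using a(2) by (simp flip: sum_distrib_left)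
  then show ?thesis
    by (intro in_dilateI[where a = "\<lambda>B. c * a B"]) (simp_all add: a assms(2) sum_distrib_left mult.assoc)
qed

lemma in_dilate_sum:
  assumes "finite J" "\<And>j. j \<in> J \<Longrightarrow> in_dilate Bs (t j) (x j)"
  shows "in_dilate Bs (sum t J) (\<lambda>i. \<Sum>j\<in>J. x j i)"
  using assms
  by (induction J rule: finite_induct) (auto intro: in_dilate_zero in_dilate_add)

lemma in_dilate_mono:
  assumes "in_dilate Bs t x" "Bs \<subseteq> Cs" "finite Cs"
  shows "in_dilate Cs t x"
proof -
  obtain a where a: "\<And>B. B \<in> Bs \<Longrightarrow> 0 \<le> a B" "sum a Bs = t" "\<And>i. x i = (\<Sum>B\<in>Bs. a B * indicator B i)"
    using assms(1) by (rule in_dilateE) blast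
  let ?b = "\<lambda>B. if B \<in> Bs then a B else 0"
  have "sum ?b Cs = t"
    using a(2) assms(2,3) sum.mono_neutral_cong_right[of Cs Bs ?b a] by auto
  moreover have "(\<Sum>B\<in>Cs. ?b B * indicator B i) = x i" for i
    using assms(2,3) a(3)[of i] sum.mono_neutral_cong_right[of Cs Bs "\<lambda>B. ?b B * indicator B i" "\<lambda>B. a B * indicator B i"]
    by auto
  ultimately show ?thesis
    using a(1) by (intro in_dilateI[where a = ?b]) auto
qed

lemma sum_indicator_mix:
  assumes "finite S" and x: "\<And>i. x i = (\<Sum>B\<in>Bs. a B * indicator B i)"
  shows "sum x S = (\<Sum>B\<in>Bs. a B * real (card (B \<inter> S)))"
proof -
  have "sum x S = (\<Sum>B\<in>Bs. \<Sum>i\<in>S. a B * indicator B i)"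
    unfolding x by (rule sum.swap)
  also have "\<dots> = (\<Sum>B\<in>Bs. a B * real (card (B \<inter> S)))"
    using assms(1)
    by (intro sum.cong refl) (simp add: sum_distrib_left[symmetric] indicator_def sum_of_bool_eq Int_commute)
  finally show ?thesis .
qed

text \<open>With \<open>m = t\<close> this is the dilate of the polytope of the minimal matroid on \<open>H\<close> and \<open>E - H\<close>.\<close>

definition slab :: "'a set \<Rightarrow> 'a set \<Rightarrow> real \<Rightarrow> real \<Rightarrow> ('a \<Rightarrow> real) set" where
  "slab E H t m = {x. (\<forall>i. i \<notin> E \<longrightarrow> x i = 0) \<and> (\<forall>i. 0 \<le> x i \<and> x i \<le> t) \<and>
     sum x E = t * real (card H) \<and> t * real (card H) - m \<le> sum x H}"

lemma in_dilate_box: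
  assumes "finite E" "\<And>B. B \<in> Bs \<Longrightarrow> B \<subseteq> E \<and> card B = k" "in_dilate Bs t x"
  shows "(\<forall>i. i \<notin> E \<longrightarrow> x i = 0) \<and> (\<forall>i. 0 \<le> x i \<and> x i \<le> t) \<and> sum x E = t * real k"
proof -
  obtain a where a: "\<And>B. B \<in> Bs \<Longrightarrow> 0 \<le> a B" "sum a Bs = t" "\<And>i. x i = (\<Sum>B\<in>Bs. a B * indicator B i)"
    using assms(3) by (rule in_dilateE) blast
  have "x i = 0" if "i \<notin> E" for i
    unfolding a(3) using assms(2) that by (intro sum.neutral ballI) (auto simp: indicator_def)
  moreover have "x i \<ge> 0" for i unfolding a(3) by (intro sum_nonneg) (simp add: a)
  moreover have "x i \<le> t" for i
    unfolding a(3) a(2)[symmetric] by (intro sum_mono) (simp add: a indicator_def)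
  moreover have "sum x E = t * real k"
  proof -
    have "sum x E = (\<Sum>B\<in>Bs. a B * real (card (B \<inter> E)))"
      by (rule sum_indicator_mix[OF assms(1) a(3)])
    also have "\<dots> = (\<Sum>B\<in>Bs. a B * real k)"
      using assms(2) by (intro sum.cong refl) (metis inf.absorb1)
    also have "\<dots> = t * real k" using a(2) by (simp flip: sum_distrib_right)
    finally show ?thesis .
  qed
  ultimately show ?thesis by blast
qed

text \<open>\<open>H\<close> and its single exchanges with the complement. For
  \<open>E = {1..n}\<close> and \<open>H = {1..k}\<close> these are the bases of the minimal
  matroid; for a circuit-hyperplane \<open>H\<close> they are among the bases of the
  relaxation.\<close>

definition star_bases :: "'a set \<Rightarrow> 'a set \<Rightarrow> 'a set set" where
  "star_bases E H = insert H ((\<lambda>(h, g). insert g (H - {h})) ` (H \<times> (E - H)))"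

text \<open>
  For \<open>x\<close> in the slab, let \<open>s\<close> be the total of the entries outside \<open>H\<close>, which is also the total of
  \<open>t - x h\<close> over \<open>h \<in> H\<close>.  The product weights \<open>(t - x h) * x g / s\<close> then transport the one to the
  other; the case \<open>s = 0\<close> is covered by \<open>x / 0 = 0\<close>.
\<close>

lemma star_dilate:
  assumes fin: "finite E" and sub: "H \<subseteq> E" and t: "t \<ge> 0"
  shows "in_dilate (star_bases E H) t x \<longleftrightarrow> x \<in> slab E H t t"
proof -
  have finH: "finite H" using fin sub finite_subset by auto
  have finS: "finite (star_bases E H)" unfolding star_bases_def using fin finH by auto
  have 1: "x \<in> slab E H t t" if q: "in_dilate (star_bases E H) t x"
  proof -
    have card: "B \<subseteq> E \<and> card B = card H" if "B \<in> star_bases E H" for B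
      using that sub finH unfolding star_bases_def
      by (auto simp: card_insert_if card_Diff_singleton_if)
         (metis Suc_pred card_gt_0_iff empty_iff)+
    have cardH: "card H - 1 \<le> card (B \<inter> H)" if "B \<in> star_bases E H" for B
    proof -
      have "B = H \<or> (\<exists>h\<in>H. H - {h} \<subseteq> B \<inter> H)" using that unfolding star_bases_def by auto
      then show ?thesis
      proof
        assume "\<exists>h\<in>H. H - {h} \<subseteq> B \<inter> H"
        then obtain h where "h \<in> H" "H - {h} \<subseteq> B \<inter> H" by auto
        then show ?thesis using finH by (metis card_Diff_singleton card_mono finite_Int)
      qed simp
    qed
    obtain a where a: "\<And>B. B \<in> star_bases E H \<Longrightarrow> 0 \<le> a B" "sum a (star_bases E H) = t"
      "\<And>i. x i = (\<Sum>B\<in>star_bases E H. a B * indicator B i)"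
      using q by (rule in_dilateE) blast
    have "t * real (card H) - t = sum a (star_bases E H) * (real (card H) - 1)"
      by (simp add: a(2) algebra_simps)
    also have "\<dots> = (\<Sum>B\<in>star_bases E H. a B * (real (card H) - 1))"
      by (rule sum_distrib_right)
    also have "\<dots> \<le> (\<Sum>B\<in>star_bases E H. a B * real (card (B \<inter> H)))"
    proof (intro sum_mono mult_left_mono a(1))
      show "real (card H) - 1 \<le> real (card (B \<inter> H))" if "B \<in> star_bases E H" for B
        using cardH[OF that] by linarith
    qed
    also have "\<dots> = sum x H"
      by (rule sum_indicator_mix[OF finH a(3), symmetric])
    finally show "x \<in> slab E H t t"
      using in_dilate_box[OF fin card q] by (simp add: slab_def)
  qed
  have 2: "in_dilate (star_bases E H) t x" if "x \<in> slab E H t t"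
  proof -
    from that have x: "\<And>i. i \<notin> E \<Longrightarrow> x i = 0" "\<And>i. 0 \<le> x i" "\<And>i. x i \<le> t"
      "sum x E = t * real (card H)" "t * real (card H) - t \<le> sum x H"
      by (auto simp: slab_def)
    let ?G = "E - H"
    define y where "y h = t - x h" for h
    define s where "s = sum y H"
    have finG: "finite ?G" using fin by simp
    have sG: "sum x ?G = s"
      using sum.subset_diff[OF sub fin, of x] x(4) by (simp add: s_def y_def sum_subtractf algebra_simps)
    have y0: "y h \<ge> 0" for h using x(3) by (simp add: y_def)
    have s: "0 \<le> s" "s \<le> t"
      using x(5) y0 by (auto simp: s_def intro: sum_nonneg) (simp add: y_def sum_subtractf algebra_simps)
    let ?c = "\<lambda>(h, g). y h * x g / s"
    let ?w = "\<lambda>(h, g). indicator (insert g (H - {h})) :: 'a \<Rightarrow> real"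
    \<comment> \<open>The exchanged sets receive the total weight \<open>s\<close>; the rest,
      nonnegative by the slab inequality, goes to \<open>H\<close>.\<close>
    have "in_dilate (star_bases E H) ((t - s) * 1) (\<lambda>i. (t - s) * indicator H i)"
      using s finS by (intro in_dilate_scale in_dilate_single) (auto simp: star_bases_def)
    moreover have "in_dilate (star_bases E H) (\<Sum>p\<in>H \<times> ?G. ?c p * 1) (\<lambda>i. \<Sum>p\<in>H \<times> ?G. ?c p * ?w p i)"
    proof (rule in_dilate_sum)
      fix p assume "p \<in> H \<times> ?G"
      then obtain h g where p: "p = (h, g)" "h \<in> H" "g \<in> ?G" by blast
      have "insert g (H - {h}) \<in> star_bases E H" unfolding star_bases_def using p by auto
      moreover have "y h * x g / s \<ge> 0" using s y0 x(2) by simp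
      ultimately show "in_dilate (star_bases E H) (?c p * 1) (\<lambda>i. ?c p * ?w p i)"
        unfolding p(1) prod.case by (intro in_dilate_scale in_dilate_single finS)
    qed (use finH finG in auto)
    ultimately have "in_dilate (star_bases E H) ((t - s) * 1 + (\<Sum>p\<in>H \<times> ?G. ?c p * 1))
      (\<lambda>i. (t - s) * indicator H i + (\<Sum>p\<in>H \<times> ?G. ?c p * ?w p i))"
      by (rule in_dilate_add)
    moreover have "(t - s) * 1 + (\<Sum>p\<in>H \<times> ?G. ?c p * 1) = t"
    proof -
      have "(\<Sum>p\<in>H \<times> ?G. ?c p * 1) = (\<Sum>h\<in>H. \<Sum>g\<in>?G. y h * x g / s)"
        by (simp add: sum.cartesian_product case_prod_unfold)
      also have "\<dots> = sum y H * sum x ?G / s"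
        by (simp add: sum_product sum_divide_distrib)
      also have "\<dots> = s" unfolding sG s_def[symmetric] by simp
      finally show ?thesis by simp
    qed
    moreover have "(t - s) * indicator H i + (\<Sum>p\<in>H \<times> ?G. ?c p * ?w p i) = x i" for i
    proof -
      have y_s0: "y h = 0" if "s = 0" "h \<in> H" for h
        using that y0 finH unfolding s_def by (simp add: sum_nonneg_eq_0_iff)
      have x_s0: "x g = 0" if "s = 0" "g \<in> ?G" for g
        using that x(2) finG sG by (simp add: sum_nonneg_eq_0_iff)
      have sum_eq: "(\<Sum>p\<in>H \<times> ?G. ?c p * ?w p i)
          = (\<Sum>h\<in>H. \<Sum>g\<in>?G. y h * x g / s * indicator (insert g (H - {h})) i)"
        by (simp add: sum.cartesian_product case_prod_unfold)
      \<comment> \<open>An element \<open>i\<close> of \<open>H\<close> is missing only from the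
        sets with \<open>h = i\<close>, of total weight \<open>y i = t - x i\<close>; an element of
        \<open>?G\<close> lies only in the sets with \<open>g = i\<close>, of total weight
        \<open>x i\<close>.\<close>
      consider "i \<in> H" | "i \<in> ?G" | "i \<notin> E" by blast
      then show ?thesis
      proof cases
        case 1
        have "(\<Sum>h\<in>H. \<Sum>g\<in>?G. y h * x g / s * indicator (insert g (H - {h})) i)
            = (\<Sum>h\<in>H. if h = i then 0 else y h)"
        proof (rule sum.cong[OF refl])
          fix h assume h: "h \<in> H"
          have "(\<Sum>g\<in>?G. y h * x g / s * indicator (insert g (H - {h})) i)
              = (\<Sum>g\<in>?G. (if h = i then 0 else y h / s) * x g)"
            using 1 by (intro sum.cong refl) (auto simp: indicator_def)
          also have "\<dots> = (if h = i then 0 else y h / s) * s"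
            by (simp add: sG flip: sum_distrib_left)
          also have "\<dots> = (if h = i then 0 else y h)"
            using y_s0[OF _ h] by auto
          finally show "(\<Sum>g\<in>?G. y h * x g / s * indicator (insert g (H - {h})) i)
            = (if h = i then 0 else y h)" .
        qed
        also have "\<dots> = s - y i"
          using sum.remove[OF finH 1, of "\<lambda>h. if h = i then 0 else y h"] sum.remove[OF finH 1, of y]
          unfolding s_def by (simp add: if_distrib cong: if_cong)
        finally show ?thesis unfolding sum_eq using 1 by (simp add: y_def)
      next
        case 2
        have "(\<Sum>h\<in>H. \<Sum>g\<in>?G. y h * x g / s * indicator (insert g (H - {h})) i)
            = (\<Sum>h\<in>H. y h * x i / s)"
        proof (rule sum.cong[OF refl])
          fix h assume h: "h \<in> H"
          have "(\<Sum>g\<in>?G. y h * x g / s * indicator (insert g (H - {h})) i)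
              = (\<Sum>g\<in>?G. if g = i then y h * x g / s else 0)"
            using 2 by (intro sum.cong refl) (auto simp: indicator_def)
          also have "\<dots> = y h * x i / s" using 2 finG by simp
          finally show "(\<Sum>g\<in>?G. y h * x g / s * indicator (insert g (H - {h})) i) = y h * x i / s" .
        qed
        also have "\<dots> = s * x i / s"
          unfolding s_def by (simp add: sum_distrib_right sum_divide_distrib)
        also have "\<dots> = x i" using x_s0[OF _ 2] by auto
        finally show ?thesis unfolding sum_eq using 2 by simp
      next
        case 3
        then have "(\<Sum>h\<in>H. \<Sum>g\<in>?G. y h * x g / s * indicator (insert g (H - {h})) i) = 0"
          using sub by (intro sum.neutral ballI) (auto simp: indicator_def)
        then show ?thesis unfolding sum_eq using 3 x(1) sub by (auto simp: indicator_def)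
      qed
    qed
    ultimately show "in_dilate (star_bases E H) t x" by simp
  qed
  show ?thesis using 1 2 by blast
qed

lemma real_nat_floor: "r \<in> \<int> \<Longrightarrow> r \<ge> 0 \<Longrightarrow> real (nat \<lfloor>r\<rfloor>) = r"
  by (elim Ints_cases) simp

text \<open>The shortfalls \<open>t - x i\<close> on \<open>H\<close> and the entries of
  \<open>x\<close> off \<open>H\<close> are weak compositions of the same number
  \<open>s \<le> m\<close>. Since \<open>m \<le> t\<close>, no part exceeds \<open>t\<close>, so the
  box constraints hold by themselves.\<close>

lemma card_slab:
  fixes t m :: nat
  assumes fin: "finite E" and sub: "H \<subseteq> E" and card: "card H = Suc a" "card (E - H) = Suc b" and m: "m \<le> t"
  shows "card {x \<in> slab E H (real t) (real m). integral_fun x} = diag_sum a b (Suc m)"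
    and "finite {x \<in> slab E H (real t) (real m). integral_fun x}"
proof -
  let ?G = "E - H"
  let ?X = "{x \<in> slab E H (real t) (real m). integral_fun x}"
  let ?C = "\<lambda>A s. {y :: 'a \<Rightarrow> nat. (\<forall>i. i \<notin> A \<longrightarrow> y i = 0) \<and> sum y A = s}"
  let ?T = "SIGMA s:{..m}. ?C H s \<times> ?C ?G s"
  let ?f = "\<lambda>(s, y, z). \<lambda>i. if i \<in> H then real t - real (y i) else real (z i)"
  let ?y = "\<lambda>x i. if i \<in> H then nat \<lfloor>real t - x i\<rfloor> else 0"
  let ?z = "\<lambda>x i. if i \<in> ?G then nat \<lfloor>x i\<rfloor> else 0"
  let ?g = "\<lambda>x. (sum (?y x) H, ?y x, ?z x)"
  have finH: "finite H" and finG: "finite ?G" using fin sub finite_subset by auto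
  have ne: "H \<noteq> {}" "?G \<noteq> {}" using card by (metis card.empty nat.distinct(1))+
  have x: "\<And>i. i \<notin> E \<Longrightarrow> x i = 0" "\<And>i. 0 \<le> x i" "\<And>i. x i \<le> real t" "\<And>i. x i \<in> \<int>"
    "sum x E = real t * real (card H)" "real t * real (card H) - real m \<le> sum x H"
    if "x \<in> ?X" for x
    using that by (auto simp: slab_def integral_fun_def)
  have yr: "real (?y x i) = real t - x i" if "x \<in> ?X" "i \<in> H" for x i
    using x[OF that(1)] that(2) real_nat_floor[of "real t - x i"] by simp
  have zr: "real (?z x i) = x i" if "x \<in> ?X" "i \<in> ?G" for x i
    using x[OF that(1)] that(2) real_nat_floor[of "x i"] by simp
  have ysum: "real (sum (?y x) H) = real t * real (card H) - sum x H" if "x \<in> ?X" for x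
    unfolding of_nat_sum using sum.cong[OF refl yr[OF that], of H] by (simp add: sum_subtractf mult.commute)
  have zsum: "real (sum (?z x) ?G) = real t * real (card H) - sum x H" if "x \<in> ?X" for x
    unfolding of_nat_sum using sum.cong[OF refl zr[OF that], of ?G] sum.subset_diff[OF sub fin, of x] x(5)[OF that]
    by simp
  have "bij_betw ?f ?T ?X"
  proof (rule bij_betw_byWitness[where f' = ?g])
    show "\<forall>p\<in>?T. ?g (?f p) = p"
    proof
      fix p assume "p \<in> ?T"
      then obtain s y z where p: "p = (s, y, z)" "y \<in> ?C H s" "z \<in> ?C ?G s" by auto
      have "?y (?f p) = y" using p by (auto simp: fun_eq_iff)
      moreover have "?z (?f p) = z" using p by (auto simp: fun_eq_iff)
      moreover have "sum y H = s" using p by simp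
      ultimately show "?g (?f p) = p" unfolding p(1) by simp
    qed
    show "\<forall>x\<in>?X. ?f (?g x) = x"
    proof
      fix w assume w: "w \<in> ?X"
      have "?f (?g w) i = w i" for i
        using yr[OF w, of i] zr[OF w, of i] x(1)[OF w, of i] by (cases "i \<in> H"; cases "i \<in> E") auto
      then show "?f (?g w) = w" by blast
    qed
    show "?f ` ?T \<subseteq> ?X"
    proof (rule image_subsetI)
      fix p assume "p \<in> ?T"
      then obtain s y z where p: "p = (s, y, z)" "s \<le> m" "\<And>i. i \<notin> H \<Longrightarrow> y i = 0" "sum y H = s"
        "\<And>i. i \<notin> ?G \<Longrightarrow> z i = 0" "sum z ?G = s" by auto
      define w where "w = ?f p"
      have w: "w i = (if i \<in> H then real t - real (y i) else real (z i))" for i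
        unfolding w_def p(1) by simp
      have "y i \<le> t" for i
        using p(2-4) m member_le_sum[of i H y] finH by (cases "i \<in> H") auto
      moreover have "z i \<le> t" for i
        using p(2,5,6) m member_le_sum[of i ?G z] finG by (cases "i \<in> ?G") auto
      ultimately have "0 \<le> w i \<and> w i \<le> real t" for i by (simp add: w)
      moreover have "w i = 0" if "i \<notin> E" for i using that sub p(5) by (auto simp: w)
      moreover have sH: "sum w H = real t * real (card H) - real s"
        using p(4) by (simp add: w sum_subtractf flip: of_nat_sum)
      moreover have "sum w ?G = real s"
        using p(6) by (simp add: w flip: of_nat_sum)
      then have "sum w E = real t * real (card H)"
        using sum.subset_diff[OF sub fin, of w] sH by simp
      moreover have "w i \<in> \<int>" for i by (simp add: w)
      ultimately show "?f p \<in> ?X" using p(2) unfolding w_def[symmetric]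
        by (simp add: slab_def integral_fun_def)
    qed
    show "?g ` ?X \<subseteq> ?T"
    proof (rule image_subsetI)
      fix w assume w: "w \<in> ?X"
      have "real (sum (?y w) H) \<le> real m" unfolding ysum[OF w] using x(6)[OF w] by linarith
      then have "sum (?y w) H \<le> m" unfolding of_nat_le_iff .
      moreover have "sum (?z w) ?G = sum (?y w) H"
        using ysum[OF w] zsum[OF w] by (metis of_nat_eq_iff)
      ultimately show "?g w \<in> ?T" by simp
    qed
  qed
  moreover have "finite ?T"
    using weak_compositions[OF finH ne(1)] weak_compositions[OF finG ne(2)] by auto
  moreover have "card ?T = diag_sum a b (Suc m)"
  proof -
    have "card ?T = (\<Sum>s\<le>m. card (?C H s \<times> ?C ?G s))"
      using weak_compositions[OF finH ne(1)] weak_compositions[OF finG ne(2)]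
      by (intro card_SigmaI) auto
    also have "\<dots> = (\<Sum>s\<le>m. ((s + a) choose a) * ((s + b) choose b))"
      using weak_compositions[OF finH ne(1)] weak_compositions[OF finG ne(2)] card
      by (simp add: card_cartesian_product)
    finally show ?thesis unfolding diag_sum_def by (simp add: lessThan_Suc_atMost)
  qed
  ultimately show "card ?X = diag_sum a b (Suc m)" "finite ?X"
    by (auto dest: bij_betw_same_card simp: bij_betw_finite)
qed


section \<open>The minimal matroid\<close>

text \<open>The end \<open>v\<close> is shared with the preceding or the following edge in the
  cyclic order, which is a different edge because two-element ends rule out loops. Forests can thus
  be recognized by exhibiting leaves.\<close>

lemma graph_cycle_no_leaf:
  assumes cyc: "graph_cycle ends C" and two: "\<And>e. e \<in> C \<Longrightarrow> card (ends e) = 2"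
    and e: "e \<in> C" "v \<in> ends e"
  shows "\<exists>e'\<in>C. e' \<noteq> e \<and> v \<in> ends e'"
proof -
  obtain es vs where c: "es \<noteq> []" "length vs = length es" "distinct es" "set es = C"
    "\<And>i. i < length es \<Longrightarrow> ends (es ! i) = {vs ! i, vs ! (Suc i mod length es)}"
    using cyc unfolding graph_cycle_def by blast
  obtain i where i: "i < length es" "es ! i = e" using e(1) c(4) by (metis in_set_conv_nth)
  have m2: "length es > 1"
  proof (rule ccontr)
    assume "\<not> ?thesis"
    then have "length es = 1" using c(1) by (cases es) auto
    then have "ends e = {vs ! 0}" using c(5)[OF i(1)] i by simp
    then show False using two[OF e(1)] by simp
  qed
  have *: ?thesis if "j < length es" "j \<noteq> i" "v \<in> ends (es ! j)" for j
    using that i c(4) nth_eq_iff_index_eq[OF c(3) that(1) i(1)] nth_mem[OF that(1)]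
    by (intro bexI[of _ "es ! j"]) auto
  consider "v = vs ! i" | "v = vs ! (Suc i mod length es)"
    using e(2) c(5)[OF i(1)] i(2) by blast
  then show ?thesis
  proof cases
    case 1
    let ?j = "if i = 0 then length es - 1 else i - 1"
    have j: "?j < length es" "?j \<noteq> i" "Suc ?j mod length es = i"
      using i(1) m2 by auto
    show ?thesis using *[OF j(1,2)] c(5)[OF j(1)] j(3) 1 by auto
  next
    case 2
    let ?j = "Suc i mod length es"
    have j: "?j < length es" using i(1) by (intro mod_less_divisor) auto
    have "?j \<noteq> i"
    proof (cases "Suc i = length es")
      case False
      then show ?thesis using i(1) by simp
    qed (use m2 in auto)
    then show ?thesis using *[OF j] c(5)[OF j] 2 by auto
  qed
qed

context
  fixes k n :: nat and ends :: "nat \<Rightarrow> nat set"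
  assumes k: "1 \<le> k"
  defines "ends \<equiv> \<lambda>i. if i \<le> k then {i - 1, i} else {k, 0}"
begin

lemma card_ends: "1 \<le> i \<Longrightarrow> card (ends i) = 2"
  using k by (auto simp: ends_def card_insert_if)

text \<open>The label \<open>0\<close> is excluded because natural subtraction makes
  \<open>ends 0\<close> the singleton \<open>{0}\<close>.\<close>

lemma no_leaf:
  assumes "graph_cycle ends C" "0 \<notin> C" "e \<in> C" "v \<in> ends e"
  shows "\<exists>e'\<in>C. e' \<noteq> e \<and> v \<in> ends e'"
proof (rule graph_cycle_no_leaf[OF assms(1) card_ends assms(3,4)])
  show "1 \<le> i" if "i \<in> C" for i
    using that assms(2) by (cases i) auto
qed

lemma graph_cycle_props: "graph_cycle ends C \<Longrightarrow> finite C \<and> C \<noteq> {}"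
  unfolding graph_cycle_def by auto

text \<open>The largest edge \<open>m\<close> of a cycle would have the leaf \<open>m\<close>, as
  only the edges \<open>m\<close> and \<open>m + 1\<close> of the path meet this vertex.\<close>

lemma forest_path: "graph_forest ends {1..k}"
  unfolding graph_forest_def
proof
  assume "\<exists>C\<subseteq>{1..k}. graph_cycle ends C"
  then obtain C where C: "C \<subseteq> {1..k}" "graph_cycle ends C" by blast
  define m where "m = Max C"
  have fin: "finite C" "C \<noteq> {}" using graph_cycle_props C by auto
  then have m: "m \<in> C" unfolding m_def by (rule Max_in)
  then have "m \<in> ends m" using C(1) by (auto simp: ends_def)
  then obtain e where e: "e \<in> C" "e \<noteq> m" "m \<in> ends e"
    using no_leaf[OF C(2) _ m] C(1) by fastforce
  then have "e \<le> m" unfolding m_def using fin by simp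
  then show False using e C(1) by (auto simp: ends_def split: if_splits)
qed

text \<open>In a cycle, the smallest path edge \<open>m\<close> above \<open>h\<close> would have
  the leaf \<open>m - 1\<close>, and the largest edge \<open>m\<close> below \<open>h\<close> the
  leaf \<open>m\<close>; the edge \<open>g\<close> meets neither, as it joins \<open>k\<close> and
  \<open>0\<close>. What remains is \<open>g\<close> alone, which has leaves itself.\<close>

lemma forest_broken_path:
  assumes h: "h \<in> {1..k}" and g: "k < g"
  shows "graph_forest ends (insert g ({1..k} - {h}))"
  unfolding graph_forest_def
proof
  assume "\<exists>C\<subseteq>insert g ({1..k} - {h}). graph_cycle ends C"
  then obtain C where C: "C \<subseteq> insert g ({1..k} - {h})" "graph_cycle ends C" by blast
  have fin: "finite C" "C \<noteq> {}" using graph_cycle_props C by auto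
  have el: "e = g \<or> (1 \<le> e \<and> e \<le> k \<and> e \<noteq> h)" if "e \<in> C" for e using C(1) that by auto
  have C0: "0 \<notin> C" using el[of 0] g by auto
  have upper: "\<not> (h < e \<and> e \<le> k)" if "e \<in> C" for e
  proof
    assume e: "h < e \<and> e \<le> k"
    define S where "S = {e \<in> C. h < e \<and> e \<le> k}"
    define m where "m = Min S"
    have S: "finite S" "S \<noteq> {}" using fin e that by (auto simp: S_def)
    then have m: "m \<in> S" unfolding m_def by (rule Min_in)
    then have mC: "m \<in> C" "h < m" "m \<le> k" by (auto simp: S_def)
    then have "m - 1 \<in> ends m" by (auto simp: ends_def)
    then obtain f where f: "f \<in> C" "f \<noteq> m" "m - 1 \<in> ends f"
      using no_leaf[OF C(2) C0 mC(1)] by blast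
    have "f \<notin> S \<or> m \<le> f" unfolding m_def using S(1) by auto
    then show False
      using f el[OF f(1)] mC h g by (auto simp: ends_def S_def split: if_splits)
  qed
  have lower: "\<not> e < h" if "e \<in> C" for e
  proof
    assume e: "e < h"
    define S where "S = {e \<in> C. e < h}"
    define m where "m = Max S"
    have S: "finite S" "S \<noteq> {}" using fin e that by (auto simp: S_def)
    then have m: "m \<in> S" unfolding m_def by (rule Max_in)
    then have mC: "m \<in> C" "m < h" by (auto simp: S_def)
    then have "m \<in> ends m" using h by (auto simp: ends_def)
    then obtain f where f: "f \<in> C" "f \<noteq> m" "m \<in> ends f"
      using no_leaf[OF C(2) C0 mC(1)] by blast
    have "f \<notin> S \<or> f \<le> m" unfolding m_def using S(1) by auto
    then show False
      using f el[OF f(1)] el[OF mC(1)] mC h g upper[OF f(1)]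
      by (auto simp: ends_def S_def split: if_splits)
  qed
  have Cg: "C \<subseteq> {g}" using el upper lower by (metis linorder_neqE_nat singletonI subsetI)
  then have "g \<in> C" using fin by auto
  moreover have "k \<in> ends g" using g by (simp add: ends_def)
  ultimately show False using no_leaf[OF C(2) C0, of g k] Cg by blast
qed

lemma parallel_cycle:
  assumes "k < g" "k < g'" "g \<noteq> g'"
  shows "graph_cycle ends {g, g'}"
  unfolding graph_cycle_def
  using assms k
  by (intro exI[of _ "[g, g']"] exI[of _ "[k, 0]"])
    (auto simp: ends_def less_Suc_eq numeral_2_eq_2)

lemma long_cycle:
  assumes "k < g"
  shows "graph_cycle ends (insert g {1..k})"
  unfolding graph_cycle_def
proof (intro exI conjI allI impI)
  \<comment> \<open>For \<open>i < k\<close> the edge at index \<open>i\<close> is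
    \<open>i + 1\<close>, joining the vertices \<open>i\<close> and \<open>i + 1\<close>; at index
    \<open>k\<close> the \<open>mod\<close> lets \<open>g\<close> return to
    \<open>0\<close>.\<close>
  let ?es = "[1..<Suc k] @ [g]" and ?vs = "[0..<Suc k]"
  show "?es \<noteq> []" "length ?vs = length ?es" "distinct ?es" "distinct ?vs" "set ?es = insert g {1..k}"
    using assms by auto
  fix i assume i: "i < length ?es"
  show "ends (?es ! i) = {?vs ! i, ?vs ! (Suc i mod length ?es)}"
  proof (cases "i = k")
    case True
    then show ?thesis using assms by (auto simp: ends_def nth_append simp del: upt_Suc)
  next
    case False
    then show ?thesis using i by (auto simp: ends_def nth_append simp del: upt_Suc)
  qed
qed

text \<open>Two kinds of cycles suffice: no forest contains the whole path and a parallel edge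
  (\<open>path\<close>), or two parallel edges (\<open>par\<close>). Hence the star sets, which are
  forests, are maximal (\<open>max\<close>), and every forest lies in one of them
  (\<open>cover\<close>).\<close>

lemma minimal_matroid_bases: "bases (minimal_matroid k n) = star_bases {1..n} {1..k}" if "k < n"
proof -
  let ?F = "\<lambda>X. X \<subseteq> {1..n} \<and> graph_forest ends X"
  have b: "bases (minimal_matroid k n) = {X. ?F X \<and> (\<forall>Y. X \<subset> Y \<longrightarrow> \<not> ?F Y)}"
    by (auto simp: minimal_matroid_def cycle_matroid_def ends_def)
  have star: "X \<in> star_bases {1..n} {1..k} \<longleftrightarrow> X = {1..k} \<or> (\<exists>h g. h \<in> {1..k} \<and> k < g \<and> g \<le> n \<and> X = insert g ({1..k} - {h}))" for X
    using k by (force simp: star_bases_def)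
  have F: "?F X" if "X \<in> star_bases {1..n} {1..k}" for X
    using that \<open>k < n\<close> forest_path forest_broken_path unfolding star by auto
  have path: "\<not> ?F Y" if "insert g {1..k} \<subseteq> Y" "k < g" for Y g
    using long_cycle[OF that(2)] that(1) unfolding graph_forest_def by blast
  have par: "\<not> ?F Y" if "{g, g'} \<subseteq> Y" "k < g" "k < g'" "g \<noteq> g'" for Y g g'
    using parallel_cycle[OF that(2-4)] that(1) unfolding graph_forest_def by blast
  have max: "\<not> ?F Y" if X: "X \<in> star_bases {1..n} {1..k}" and Y: "X \<subset> Y" for X Y
  proof
    assume FY: "?F Y"
    obtain y where y: "y \<in> Y" "y \<notin> X" using Y by blast
    then have yn: "1 \<le> y" "y \<le> n" using FY by auto
    show False
    proof (cases "X = {1..k}")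
      case True
      then have "k < y" using y yn by auto
      then show False using path[of y Y] True y Y FY by blast
    next
      case False
      then obtain h g where hg: "h \<in> {1..k}" "k < g" "g \<le> n" "X = insert g ({1..k} - {h})"
        using X unfolding star by blast
      show False
      proof (cases "y \<le> k")
        case True
        then have "y = h" using y(2) yn hg(4) by auto
        then have "insert g {1..k} \<subseteq> Y" using y Y hg(4) by blast
        then show False using path[of g Y] hg(2) FY by simp
      next
        case False
        moreover have "{g, y} \<subseteq> Y" "g \<noteq> y" using y Y hg(4) by auto
        ultimately show False using par[of g y Y] hg(2) FY by simp
      qed
    qed
  qed
  have cover: "\<exists>S\<in>star_bases {1..n} {1..k}. X \<subseteq> S" if FX: "?F X" for X
  proof (cases "X \<subseteq> {1..k}")
    case True
    then show ?thesis unfolding star_bases_def by blast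
  next
    case False
    then obtain g where "g \<in> X" "g \<notin> {1..k}" by blast
    moreover then have "g \<in> {1..n}" using FX by blast
    ultimately have g: "g \<in> X" "k < g" "g \<le> n" by auto
    then obtain h where h: "h \<in> {1..k}" "h \<notin> X" using path[of g X] FX by blast
    have "x = g \<or> x \<in> {1..k} - {h}" if "x \<in> X" for x
    proof (rule ccontr)
      assume n: "\<not> ?thesis"
      have "x \<in> {1..n}" "x \<noteq> h" using FX that h by auto
      then have "k < x" using n by auto
      moreover have "{g, x} \<subseteq> X" "g \<noteq> x" using that g n by auto
      ultimately show False using par[of g x X] FX g by simp
    qed
    then have "X \<subseteq> insert g ({1..k} - {h})" by blast
    moreover have "insert g ({1..k} - {h}) \<in> star_bases {1..n} {1..k}"
      unfolding star using g h by blast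
    ultimately show ?thesis by (intro bexI)
  qed
  show ?thesis unfolding b
  proof (intro equalityI subsetI)
    fix X assume "X \<in> {X. ?F X \<and> (\<forall>Y. X \<subset> Y \<longrightarrow> \<not> ?F Y)}"
    then have X: "?F X" "\<And>Y. X \<subset> Y \<Longrightarrow> \<not> ?F Y" by simp_all
    obtain S where S: "S \<in> star_bases {1..n} {1..k}" "X \<subseteq> S" using cover[OF X(1)] by (elim bexE)
    have "X = S" using X(2)[of S] F[OF S(1)] S(2) by blast
    then show "X \<in> star_bases {1..n} {1..k}" using S(1) by simp
  next
    fix X assume X: "X \<in> star_bases {1..n} {1..k}"
    then show "X \<in> {X. ?F X \<and> (\<forall>Y. X \<subset> Y \<longrightarrow> \<not> ?F Y)}"
      using F[OF X] max[OF X] by simp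
  qed
qed

end


section \<open>Relaxation of a circuit-hyperplane\<close>

lemma matroidD:
  assumes "matroid M"
  shows "finite (ground M)" "bases M \<noteq> {}" "B \<in> bases M \<Longrightarrow> B \<subseteq> ground M"
  using assms by (simp_all add: matroid_def)

lemma finite_bases:
  assumes "matroid M"
  shows "finite (bases M)"
proof (rule finite_subset)
  show "bases M \<subseteq> Pow (ground M)" using matroidD(3)[OF assms] by blast
  show "finite (Pow (ground M))" using matroidD(1)[OF assms] by simp
qed

lemma basis_exchange:
  assumes "matroid M" "B1 \<in> bases M" "B2 \<in> bases M" "x \<in> B1" "x \<notin> B2"
  obtains y where "y \<in> B2" "y \<notin> B1" "insert y (B1 - {x}) \<in> bases M"
proof -
  have "\<exists>y\<in>B2 - B1. insert y (B1 - {x}) \<in> bases M"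
    using assms(1)[unfolded matroid_def] assms(2-5) by (elim conjE) simp
  then obtain y where "y \<in> B2 - B1" "insert y (B1 - {x}) \<in> bases M" by (rule bexE)
  then show ?thesis using that[of y] by simp
qed

lemma basis_finite: "matroid M \<Longrightarrow> B \<in> bases M \<Longrightarrow> finite B"
  using matroidD(1,3) finite_subset by metis

text \<open>Exchange keeps the cardinality and brings \<open>B1\<close> closer to \<open>B2\<close>.
  Once \<open>B1 \<subseteq> B2\<close>, an element of \<open>B2\<close> outside \<open>B1\<close>
  would have no replacement in \<open>B1\<close>, so the two coincide.\<close>

lemma card_bases_eq:
  assumes M: "matroid M" and "B1 \<in> bases M" "B2 \<in> bases M"
  shows "card B1 = card B2"
  using assms(2)
proof (induction "card (B1 - B2)" arbitrary: B1 rule: less_induct)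
  case (less B1)
  show ?case
  proof (cases "B1 \<subseteq> B2")
    case True
    have "B2 \<subseteq> B1"
    proof
      fix x assume "x \<in> B2"
      then show "x \<in> B1"
        using basis_exchange[OF M assms(3) less.prems, of x] True by blast
    qed
    then show ?thesis using True by auto
  next
    case False
    then obtain x where x: "x \<in> B1" "x \<notin> B2" by auto
    obtain y where y: "y \<in> B2" "y \<notin> B1" "insert y (B1 - {x}) \<in> bases M"
      using basis_exchange[OF M less.prems assms(3) x] by blast
    have fin: "finite B1" using basis_finite[OF M less.prems] .
    have "insert y (B1 - {x}) - B2 \<subset> B1 - B2" using x y by auto
    then have "card (insert y (B1 - {x}) - B2) < card (B1 - B2)"
      using fin by (intro psubset_card_mono) auto
    then have "card (insert y (B1 - {x})) = card B2" using less.hyps y(3) by blast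
    moreover have "card (insert y (B1 - {x})) = card B1"
      using fin x y card_Suc_Diff1[of B1 x] by simp
    ultimately show ?thesis by simp
  qed
qed

lemma finite_indep_subsets:
  assumes "matroid M"
  shows "finite {I. I \<subseteq> X \<and> indep M I}"
proof (rule finite_subset)
  show "{I. I \<subseteq> X \<and> indep M I} \<subseteq> Pow (ground M)"
    using matroidD(3)[OF assms] unfolding indep_def by blast
  show "finite (Pow (ground M))" using matroidD(1)[OF assms] by simp
qed

lemma card_indep_le_rk:
  assumes "matroid M" "I \<subseteq> X" "indep M I"
  shows "card I \<le> rk M X"
  unfolding rk_def using finite_indep_subsets[OF assms(1), of X] assms(2,3) by (intro Max_ge) auto

lemma rk_attained:
  assumes "matroid M"
  obtains I where "I \<subseteq> X" "indep M I" "card I = rk M X"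
proof -
  have "indep M {}" using matroidD(2)[OF assms] unfolding indep_def by auto
  then have "rk M X \<in> card ` {I. I \<subseteq> X \<and> indep M I}"
    unfolding rk_def using finite_indep_subsets[OF assms, of X] by (intro Max_in) auto
  then show ?thesis using that by auto
qed

lemma card_basis:
  assumes M: "matroid M" and B: "B \<in> bases M"
  shows "card B = matroid_rank M"
proof -
  have "B \<subseteq> ground M" "indep M B" using matroidD(3)[OF M] B by (auto simp: indep_def)
  then have "card B \<le> matroid_rank M"
    unfolding matroid_rank_def by (intro card_indep_le_rk[OF M])
  moreover obtain I where "I \<subseteq> ground M" "indep M I" "card I = matroid_rank M"
    unfolding matroid_rank_def using rk_attained[OF M] .
  moreover from this obtain C where "C \<in> bases M" "I \<subseteq> C" by (auto simp: indep_def)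
  ultimately show ?thesis
    using card_bases_eq[OF M B] card_mono basis_finite[OF M] by (metis le_antisym)
qed

section \<open>Exchanges with a circuit-hyperplane\<close>

locale circuit_hyperplane_matroid =
  fixes M :: "'a basis_system" and H :: "'a set" and k :: nat
  assumes M: "matroid M" and rank: "matroid_rank M = k" and H: "circuit_hyperplane M H"
begin

abbreviation "E \<equiv> ground M"

lemma H_sub: "H \<subseteq> E" and H_dep: "\<not> indep M H" and H_min: "D \<subset> H \<Longrightarrow> indep M D"
  and H_rk: "rk M H + 1 = k" and H_flat: "g \<in> E - H \<Longrightarrow> rk M H < rk M (insert g H)"
  using H rank unfolding circuit_hyperplane_def circuit_def hyperplane_def flat_def by auto

lemma finite_E: "finite E" using matroidD(1)[OF M] .

lemma finite_H: "finite H" using finite_E H_sub finite_subset by blast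

lemma H_ne: "H \<noteq> {}"
  using H_dep matroidD(2)[OF M] unfolding indep_def by auto

lemma H_not_basis: "H \<notin> bases M" using H_dep by (auto simp: indep_def)

lemma basis_props: "B \<in> bases M \<Longrightarrow> B \<subseteq> E \<and> card B = k \<and> finite B"
  using matroidD(3)[OF M] card_basis[OF M] basis_finite[OF M] rank by simp

lemma card_H: "card H = k"
proof -
  obtain h where h: "h \<in> H" using H_ne by auto
  then have "card (H - {h}) \<le> rk M H"
    by (intro card_indep_le_rk[OF M] H_min) auto
  then have "card H \<le> k" using h finite_H H_rk by (simp add: card_Diff_singleton)
  moreover obtain I where I: "I \<subseteq> H" "indep M I" "card I = rk M H" using rk_attained[OF M] .
  then have "I \<subset> H" using H_dep by auto
  then have "rk M H < card H" using I(3) psubset_card_mono[OF finite_H] by metis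
  ultimately show ?thesis using H_rk by simp
qed

lemma k_pos: "k > 0" using H_rk by simp

text \<open>A basis \<open>B\<close> containing \<open>H - {h}\<close> has one more element
  \<open>z\<close>, outside \<open>H\<close>, and by flatness \<open>insert g H\<close> contains a
  basis \<open>I\<close>. If \<open>z\<close> is not \<open>g\<close>, exchanging it against
  \<open>I\<close> brings in \<open>h\<close> or \<open>g\<close>, and \<open>h\<close> would make
  \<open>H\<close> a basis.\<close>

lemma exchange_H:
  assumes h: "h \<in> H" and g: "g \<in> E - H"
  shows "insert g (H - {h}) \<in> bases M"
proof -
  obtain I where I: "I \<subseteq> insert g H" "indep M I" "card I = rk M (insert g H)"
    using rk_attained[OF M] .
  obtain C where C: "C \<in> bases M" "I \<subseteq> C" using I(2) by (auto simp: indep_def)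
  have "card I \<ge> card C" using I(3) H_flat[OF g] H_rk basis_props[OF C(1)] by simp
  then have "I = C" using C basis_props[OF C(1)] card_seteq by blast
  then have IB: "I \<in> bases M" using C(1) by simp
  obtain B where B: "B \<in> bases M" "H - {h} \<subseteq> B"
    using H_min[of "H - {h}"] h by (auto simp: indep_def)
  have "card (B - (H - {h})) = 1"
    using B basis_props[OF B(1)] card_H h finite_H k_pos by (simp add: card_Diff_subset card_Diff_singleton)
  then obtain z where z: "B - (H - {h}) = {z}" by (auto simp: card_1_singleton_iff)
  then have Bz: "B = insert z (H - {h})" "z \<notin> H - {h}" using B(2) by blast+
  have "z \<noteq> h" using Bz(1) h B(1) H_not_basis by (auto simp: insert_absorb)
  then have zH: "z \<notin> H" using Bz(2) by blast
  show ?thesis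
  proof (cases "z = g")
    case True
    then show ?thesis using Bz B(1) by simp
  next
    case False
    then have "z \<notin> I" using I(1) zH by auto
    then obtain y where y: "y \<in> I" "y \<notin> B" "insert y (B - {z}) \<in> bases M"
      using basis_exchange[OF M B(1) IB] Bz(1) by blast
    have Bzz: "B - {z} = H - {h}" using Bz by auto
    have "y \<noteq> h" using y(3) h H_not_basis unfolding Bzz by (auto simp: insert_absorb)
    then have "y = g" using y(1,2) I(1) Bz(1) by auto
    then show ?thesis using y(3) Bzz by simp
  qed
qed

lemma E_H_ne: "E - H \<noteq> {}"
proof
  assume "E - H = {}"
  obtain B where B: "B \<in> bases M" using matroidD(2)[OF M] by auto
  then have "B \<subseteq> H" "card B = card H" using basis_props[OF B] \<open>E - H = {}\<close> card_H by auto
  then have "B = H" using finite_H card_subset_eq by blast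
  then show False using B H_not_basis by simp
qed

lemma star_subset: "star_bases E H \<subseteq> insert H (bases M)"
  unfolding star_bases_def using exchange_H by auto

text \<open>For a basis, \<open>card_Int_H\<close> shows that the natural subtraction is exact; it
  is the number of exchanges towards \<open>H\<close> that are still possible.\<close>

definition deficit :: "'a set \<Rightarrow> nat" where
  "deficit B = k - 1 - card (B \<inter> H)"

lemma card_Int_H: "B \<in> bases M \<Longrightarrow> card (B \<inter> H) + 1 \<le> k"
proof -
  assume B: "B \<in> bases M"
  have "B \<inter> H \<noteq> H"
  proof
    assume "B \<inter> H = H"
    then have "H = B" using basis_props[OF B] card_H finite_H by (metis card_subset_eq inf.cobounded1)
    then show False using B H_not_basis by simp
  qed
  then have "B \<inter> H \<subset> H" by blast
  then have "card (B \<inter> H) < card H" by (rule psubset_card_mono[OF finite_H])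
  then show ?thesis using card_H by simp
qed

text \<open>Both \<open>insert y (B - {x})\<close> and \<open>insert x (H - {y})\<close> are bases, and the sum of their
  indicators is that of \<open>B\<close> and \<open>H\<close>.\<close>

lemma exchange_toward_H:
  assumes B: "B \<in> bases M" and d: "deficit B > 0"
  obtains x y where "x \<in> B" "x \<in> E - H" "y \<in> H" "y \<notin> B" "insert y (B - {x}) \<in> bases M"
    "deficit (insert y (B - {x})) = deficit B - 1"
proof -
  have fB: "finite B" "card B = k" "B \<subseteq> E" using basis_props[OF B] by auto
  have "card (B \<inter> H) + card (B - H) = k"
    using fB card_Int_Diff by metis
  \<comment> \<open>Two elements outside \<open>H\<close> are needed: \<open>x\<close> leaves, while
    \<open>g\<close> stays in \<open>B\<close>, so that the element taken from
    \<open>insert g (H - {h})\<close> lies in \<open>H\<close>.\<close>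
  then have "card (B - H) \<ge> 2" using d by (simp add: deficit_def)
  then obtain g x where gx: "g \<in> B - H" "x \<in> B - H" "x \<noteq> g"
    by (metis card_le_Suc0_iff_eq fB(1) finite_Diff not_less_eq_eq numeral_2_eq_2)
  obtain h where h: "h \<in> H" using H_ne by auto
  have "insert g (H - {h}) \<in> bases M" using exchange_H h gx fB(3) by blast
  then obtain y where y: "y \<in> insert g (H - {h})" "y \<notin> B" "insert y (B - {x}) \<in> bases M"
    using basis_exchange[OF M B, of _ x] gx by blast
  have yH: "y \<in> H" using y(1,2) gx by auto
  have "insert y (B - {x}) \<inter> H = insert y (B \<inter> H)" using yH gx by auto
  then have "card (insert y (B - {x}) \<inter> H) = Suc (card (B \<inter> H))" using y(2) fB(1) by simp
  then have "deficit (insert y (B - {x})) = deficit B - 1" by (simp add: deficit_def)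
  then show ?thesis using that[of x y] gx fB(3) yH y by blast
qed

text \<open>Each step of \<open>exchange_toward_H\<close> rewrites \<open>B\<close> and one copy of
  \<open>H\<close> as two bases of \<open>M\<close>, one of them with deficit less by one. After
  \<open>deficit B\<close> steps all copies of \<open>H\<close> are used up.\<close>

lemma in_dilate_deficit:
  "B \<in> bases M \<Longrightarrow> in_dilate (bases M) (1 + real (deficit B))
     (\<lambda>i. indicator B i + real (deficit B) * indicator H i)"
proof (induction "deficit B" arbitrary: B)
  case 0
  then show ?case
    using in_dilate_single[OF finite_bases[OF M] 0(2)] by (simp add: 0(1)[symmetric])
next
  case (Suc c)
  obtain x y where xy: "x \<in> B" "x \<in> E - H" "y \<in> H" "y \<notin> B" and B': "insert y (B - {x}) \<in> bases M"
    and d: "deficit (insert y (B - {x})) = deficit B - 1"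
    using exchange_toward_H[OF Suc.prems] Suc.hyps(2) by (metis zero_less_Suc)
  let ?B = "insert y (B - {x})" and ?H = "insert x (H - {y})"
  have dc: "deficit ?B = c" using d Suc.hyps(2) by simp
  have "in_dilate (bases M) (1 + real c) (\<lambda>i. indicator ?B i + real c * indicator H i)"
    using Suc.hyps(1)[OF _ B'] dc by simp
  moreover have "in_dilate (bases M) 1 (indicator ?H)"
    using exchange_H xy by (intro in_dilate_single finite_bases M) auto
  ultimately have "in_dilate (bases M) (1 + real c + 1)
      (\<lambda>i. (indicator ?B i + real c * indicator H i) + indicator ?H i)"
    by (rule in_dilate_add)
  moreover have "(indicator ?B i + real c * indicator H i) + indicator ?H i
      = indicator B i + real (deficit B) * (indicator H i :: real)" for i
    using xy Suc.hyps(2)[symmetric] by (auto simp: indicator_def algebra_simps)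
  ultimately show ?case using Suc.hyps(2)[symmetric] by (simp add: add.assoc)
qed

lemma sum_H_le:
  assumes "in_dilate (bases M) t x"
  shows "sum x H \<le> t * (real k - 1)"
proof -
  obtain a where a: "\<And>B. B \<in> bases M \<Longrightarrow> 0 \<le> a B" "sum a (bases M) = t"
      "\<And>i. x i = (\<Sum>B\<in>bases M. a B * indicator B i)"
    using assms by (rule in_dilateE) blast
  have "sum x H = (\<Sum>B\<in>bases M. a B * real (card (B \<inter> H)))"
    by (rule sum_indicator_mix[OF finite_H a(3)])
  also have "\<dots> \<le> (\<Sum>B\<in>bases M. a B * (real k - 1))"
  proof (intro sum_mono mult_left_mono a(1))
    show "real (card (B \<inter> H)) \<le> real k - 1" if "B \<in> bases M" for B
      using card_Int_H[OF that] by linarith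
  qed
  also have "\<dots> = t * (real k - 1)" using a(2) by (simp only: sum_distrib_right[symmetric])
  finally show ?thesis .
qed

text \<open>The weight \<open>a H\<close> has to be moved to bases of \<open>M\<close>. The bound on
  \<open>sum x H\<close> says that it is at most the weighted total deficit \<open>?W\<close>, and
  \<open>in_dilate_deficit\<close> lets every basis absorb copies of \<open>H\<close> up to its
  deficit.\<close>

lemma relaxation_dilate_below:
  assumes "in_dilate (insert H (bases M)) t x" and le: "sum x H \<le> t * (real k - 1)"
  shows "in_dilate (bases M) t x"
proof -
  obtain a where a: "\<And>B. B \<in> insert H (bases M) \<Longrightarrow> 0 \<le> a B" "sum a (insert H (bases M)) = t"
      "\<And>i. x i = (\<Sum>B\<in>insert H (bases M). a B * indicator B i)"
    using assms(1) by (rule in_dilateE) blast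
  let ?W = "\<Sum>B\<in>bases M. a B * real (deficit B)"
  have fb: "finite (bases M)" by (rule finite_bases[OF M])
  have t: "t = a H + sum a (bases M)" using a(2) fb H_not_basis by simp
  have xi: "x i = a H * indicator H i + (\<Sum>B\<in>bases M. a B * indicator B i)" for i
    unfolding a(3)[of i] by (rule sum.insert[OF fb H_not_basis])
  have def: "real (deficit B) = real k - 1 - real (card (B \<inter> H))" if "B \<in> bases M" for B
    using card_Int_H[OF that] by (simp add: deficit_def of_nat_diff)
  have "sum x H = a H * real k + (\<Sum>B\<in>bases M. a B * real (card (B \<inter> H)))"
    using sum_indicator_mix[OF finite_H a(3)] fb H_not_basis card_H by simp
  moreover have "?W = sum a (bases M) * (real k - 1) - (\<Sum>B\<in>bases M. a B * real (card (B \<inter> H)))"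
    by (simp add: def right_diff_distrib sum_subtractf sum_distrib_right)
  ultimately have W: "a H \<le> ?W" using le unfolding t by (simp add: algebra_simps)
  have aH: "a H \<ge> 0" using a(1) by simp
  \<comment> \<open>Of each weight \<open>a B\<close>, the fraction \<open>1 - \<theta>\<close>
    stays at \<open>B\<close> alone and the fraction \<open>\<theta>\<close> is used for
    \<open>B\<close> with \<open>deficit B\<close> copies of \<open>H\<close>. If \<open>a H\<close>
    is positive, so is \<open>?W\<close>, and the quotient is at most 1.\<close>
  define \<theta> where "\<theta> = (if a H = 0 then 0 else a H / ?W)"
  have th: "0 \<le> \<theta>" "\<theta> \<le> 1" "\<theta> * ?W = a H"
    using W aH by (auto simp: \<theta>_def divide_le_eq)
  have "in_dilate (bases M) (a B * ((1 - \<theta>) * 1 + \<theta> * (1 + real (deficit B))))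
      (\<lambda>i. a B * ((1 - \<theta>) * indicator B i + \<theta> * (indicator B i + real (deficit B) * indicator H i)))"
    if "B \<in> bases M" for B
  proof (rule in_dilate_scale[OF in_dilate_add])
    show "in_dilate (bases M) ((1 - \<theta>) * 1) (\<lambda>i. (1 - \<theta>) * indicator B i)"
      by (rule in_dilate_scale[OF in_dilate_single[OF fb that]]) (use th in simp)
    show "in_dilate (bases M) (\<theta> * (1 + real (deficit B)))
        (\<lambda>i. \<theta> * (indicator B i + real (deficit B) * indicator H i))"
      by (rule in_dilate_scale[OF in_dilate_deficit[OF that] th(1)])
  qed (use a(1) that in simp)
  then have "in_dilate (bases M) (\<Sum>B\<in>bases M. a B * ((1 - \<theta>) * 1 + \<theta> * (1 + real (deficit B))))
      (\<lambda>i. \<Sum>B\<in>bases M. a B * ((1 - \<theta>) * indicator B i + \<theta> * (indicator B i + real (deficit B) * indicator H i)))"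
    by (rule in_dilate_sum[OF fb])
  moreover have "(\<Sum>B\<in>bases M. a B * ((1 - \<theta>) * 1 + \<theta> * (1 + real (deficit B)))) = t"
  proof -
    have "(\<Sum>B\<in>bases M. a B * ((1 - \<theta>) * 1 + \<theta> * (1 + real (deficit B))))
        = (\<Sum>B\<in>bases M. a B + \<theta> * (a B * real (deficit B)))"
      by (intro sum.cong refl) (simp add: algebra_simps)
    also have "\<dots> = sum a (bases M) + \<theta> * ?W" by (simp add: sum.distrib sum_distrib_left)
    finally show ?thesis using th(3) t by simp
  qed
  moreover have "(\<Sum>B\<in>bases M. a B * ((1 - \<theta>) * indicator B i + \<theta> * (indicator B i + real (deficit B) * indicator H i))) = x i" for i
  proof -
    have "(\<Sum>B\<in>bases M. a B * ((1 - \<theta>) * indicator B i + \<theta> * (indicator B i + real (deficit B) * indicator H i)))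
        = (\<Sum>B\<in>bases M. a B * indicator B i + \<theta> * (a B * real (deficit B)) * indicator H i)"
      by (intro sum.cong refl) (simp add: algebra_simps)
    also have "\<dots> = (\<Sum>B\<in>bases M. a B * indicator B i) + \<theta> * ?W * indicator H i"
      by (simp add: sum.distrib sum_distrib_left sum_distrib_right)
    finally show ?thesis using th(3) xi by simp
  qed
  ultimately show ?thesis by simp
qed

text \<open>Below the cut \<open>relaxation_dilate_below\<close> applies; the slab is the dilate for
  \<open>star_bases E H\<close>, all of which are bases of the relaxation. By
  \<open>sum_H_le\<close>, the strict inequality makes the alternatives exclusive.\<close>

lemma relaxation_dilate_iff:
  assumes t: "t \<ge> 0"
  shows "in_dilate (insert H (bases M)) t x \<longleftrightarrow>
    in_dilate (bases M) t x \<or> (x \<in> slab E H t t \<and> t * (real k - 1) < sum x H)"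
proof
  assume q: "in_dilate (insert H (bases M)) t x"
  show "in_dilate (bases M) t x \<or> (x \<in> slab E H t t \<and> t * (real k - 1) < sum x H)"
  proof (cases "sum x H \<le> t * (real k - 1)")
    case True
    then show ?thesis using relaxation_dilate_below[OF q] by simp
  next
    case False
    have "(\<forall>i. i \<notin> E \<longrightarrow> x i = 0) \<and> (\<forall>i. 0 \<le> x i \<and> x i \<le> t) \<and> sum x E = t * real k"
      using basis_props H_sub card_H by (intro in_dilate_box[OF finite_E _ q]) auto
    then show ?thesis using False by (auto simp: slab_def card_H algebra_simps)
  qed
next
  assume "in_dilate (bases M) t x \<or> (x \<in> slab E H t t \<and> t * (real k - 1) < sum x H)"
  then show "in_dilate (insert H (bases M)) t x"
  proof
    assume "in_dilate (bases M) t x"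
    then show ?thesis by (rule in_dilate_mono) (use finite_bases[OF M] in auto)
  next
    assume "x \<in> slab E H t t \<and> t * (real k - 1) < sum x H"
    then have "in_dilate (star_bases E H) t x" using star_dilate[OF finite_E H_sub t] by blast
    then show ?thesis by (rule in_dilate_mono[OF _ star_subset]) (use finite_bases[OF M] in auto)
  qed
qed

lemma finite_lattice_dilate: "finite {x. in_dilate (bases M) t x \<and> integral_fun x}"
proof (rule finite_subset)
  let ?I = "{y::real. y \<in> \<int> \<and> \<bar>y\<bar> \<le> t}"
  let ?P = "{f. \<forall>x. (x \<in> E \<longrightarrow> f x \<in> ?I) \<and> (x \<notin> E \<longrightarrow> f x = 0)}"
  show "finite ?P"
    by (intro finite_set_of_finite_funs finite_E finite_abs_int_segment)
  show "{x. in_dilate (bases M) t x \<and> integral_fun x} \<subseteq> ?P"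
  proof
    fix x assume "x \<in> {x. in_dilate (bases M) t x \<and> integral_fun x}"
    then have x: "in_dilate (bases M) t x" "\<And>i. x i \<in> \<int>" by (simp_all add: integral_fun_def)
    have "(\<forall>i. i \<notin> E \<longrightarrow> x i = 0) \<and> (\<forall>i. 0 \<le> x i \<and> x i \<le> t) \<and> sum x E = t * real k"
      by (rule in_dilate_box[OF finite_E _ x(1)]) (use basis_props in simp)
    then show "x \<in> ?P" using x(2) by simp
  qed
qed

text \<open>For integral points, \<open>x(H) > t k - t\<close> means
  \<open>x(H) \<ge> t k - (t - 1)\<close>, so \<open>card_slab\<close> with \<open>m = t - 1\<close>
  counts the added points. At \<open>t = 0\<close> the only candidate is the origin, which fails the
  strict inequality.\<close>

lemma card_lattice_relaxation:
  assumes a: "k = Suc a" and b: "card (E - H) = Suc b"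
  shows "card {x. in_dilate (insert H (bases M)) (real t) x \<and> integral_fun x}
    = card {x. in_dilate (bases M) (real t) x \<and> integral_fun x} + diag_sum a b t"
proof -
  let ?L = "{x. in_dilate (bases M) (real t) x \<and> integral_fun x}"
  let ?D = "{x \<in> slab E H (real t) (real t). real t * (real k - 1) < sum x H \<and> integral_fun x}"
  have "{x. in_dilate (insert H (bases M)) (real t) x \<and> integral_fun x} = ?L \<union> ?D"
    unfolding relaxation_dilate_iff[OF of_nat_0_le_iff] by blast
  moreover have "?L \<inter> ?D = {}"
  proof -
    have False if "x \<in> ?L" "x \<in> ?D" for x
      using sum_H_le[of "real t" x] that by simp
    then show ?thesis by blast
  qed
  moreover have "finite ?D \<and> card ?D = diag_sum a b t"
  proof (cases t)
    case 0
    have False if "x \<in> ?D" for x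
    proof -
      have "x i = 0" for i using that 0 by (auto simp: slab_def intro: antisym)
      then show False using that 0 by simp
    qed
    then have D: "?D = {}" by blast
    show ?thesis unfolding D using 0 by (simp add: diag_sum_def)
  next
    case (Suc m)
    have "?D = {x \<in> slab E H (real t) (real m). integral_fun x}"
    proof -
      have "real t * (real k - 1) < sum x H \<longleftrightarrow> real t * real k - real m \<le> sum x H"
        if int: "integral_fun x" for x
      proof -
        have "sum x H \<in> \<int>" using int by (auto simp: integral_fun_def intro: Ints_sum)
        then obtain z where z: "sum x H = of_int z" by (elim Ints_cases)
        have e: "real t * (real k - 1) = of_int (int t * (int k - 1))"
          "real t * real k - real m = of_int (int t * int k - int m)" by simp_all
        have "real t * (real k - 1) < sum x H \<longleftrightarrow> int t * (int k - 1) < z"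
          unfolding z e of_int_less_iff ..
        also have "\<dots> \<longleftrightarrow> int t * int k - int m \<le> z"
          using Suc by (simp add: algebra_simps) linarith
        also have "\<dots> \<longleftrightarrow> real t * real k - real m \<le> sum x H"
          unfolding z e of_int_le_iff ..
        finally show ?thesis .
      qed
      then show ?thesis using Suc by (auto simp: slab_def card_H)
    qed
    then show ?thesis
      using card_slab[OF finite_E H_sub _ b, of a m t] a card_H Suc by simp
  qed
  ultimately show ?thesis
    using finite_lattice_dilate by (simp add: card_Un_disjoint)
qed

end

section \<open>From lattice point counts to Ehrhart polynomials\<close>

text \<open>Here the whole slab with \<open>m = t\<close> is counted, which gives
  \<open>diag_sum a b (Suc t)\<close>; the composition with \<open>[:1, 1:]\<close> is this
  shift.\<close>

lemma ehrhart_minimal_matroid: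
  fixes q :: "real poly"
  assumes q: "\<And>t. poly q (real t) = real (diag_sum a b t)"
  shows "ehrhart_poly (minimal_matroid (Suc a) (a + b + 2)) = pcompose q [:1, 1:]"
proof (rule ehrhart_poly_eqI)
  fix t :: nat
  let ?M = "minimal_matroid (Suc a) (a + b + 2)"
  let ?E = "{1..a + b + 2}" and ?H = "{1..Suc a}"
  have bases: "bases ?M = star_bases ?E ?H"
    by (rule minimal_matroid_bases) simp_all
  have "card (?E - ?H) = Suc b" by (subst card_Diff_subset) auto
  then have c: "card {x \<in> slab ?E ?H (real t) (real t). integral_fun x} = diag_sum a b (Suc t)"
    by (intro card_slab) auto
  have "finite (star_bases ?E ?H)" "star_bases ?E ?H \<noteq> {}" by (auto simp: star_bases_def)
  then have "lattice_points (matroid_polytope ?M) t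
      = {x. in_dilate (star_bases ?E ?H) (real t) x \<and> integral_fun x}"
    using lattice_points_matroid[of ?M t] unfolding bases by simp
  also have "\<dots> = {x \<in> slab ?E ?H (real t) (real t). integral_fun x}"
    using star_dilate[of ?E ?H "real t"] by simp
  finally have L: "lattice_points (matroid_polytope ?M) t = {x \<in> slab ?E ?H (real t) (real t). integral_fun x}" .
  have "poly (pcompose q [:1, 1:]) (real t) = poly q (real (Suc t))"
    by (simp add: poly_pcompose add.commute)
  then show "poly (pcompose q [:1, 1:]) (real t) = real (card (lattice_points (matroid_polytope ?M) t))"
    unfolding L c q .
qed

text \<open>Existence of a counting polynomial makes the \<open>THE\<close> in
  \<open>ehrhart_poly\<close> denote it; uniqueness is part of
  \<open>ehrhart_poly_eqI\<close>.\<close>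

lemma ehrhart_poly_matroid:
  assumes "matroid M"
  shows "poly (ehrhart_poly M) (real t) = real (card (lattice_points (matroid_polytope M) t))"
proof -
  have "\<exists>p :: real poly. \<forall>t::nat. poly p (real t) = real (card (lattice_points (matroid_polytope M) t))"
    unfolding matroid_polytope_def
  proof (rule ehrhart_lattice_polytope[OF _ _ matroidD(1)[OF assms]])
    show "finite ((\<lambda>B. indicator B :: 'a \<Rightarrow> real) ` bases M)" using finite_bases[OF assms] by simp
    show "(\<lambda>B. indicator B :: 'a \<Rightarrow> real) ` bases M \<noteq> {}" using matroidD(2)[OF assms] by simp
    show "v x = 0" if "v \<in> (\<lambda>B. indicator B) ` bases M" "x \<notin> ground M" for v :: "'a \<Rightarrow> real" and x
      using that matroidD(3)[OF assms] by (fastforce simp: indicator_def)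
    show "v x \<in> \<int>" if "v \<in> (\<lambda>B. indicator B) ` bases M" for v :: "'a \<Rightarrow> real" and x
      using that by (auto simp: indicator_def)
  qed
  then obtain p :: "real poly"
    where p: "\<And>t::nat. poly p (real t) = real (card (lattice_points (matroid_polytope M) t))"
    by blast
  then show ?thesis using ehrhart_poly_eqI[OF p] by simp
qed

theorem theorem5p4:
  fixes M :: "'a basis_system" and H :: "'a set" and k n :: nat
  assumes "matroid M"
    and "matroid_connected M"
    and "matroid_rank M = k"
    and "card (ground M) = n"
    and "circuit_hyperplane M H"
  shows "(\<forall>t::real. poly (ehrhart_poly (relaxation M H)) t =
                    poly (ehrhart_poly M) t + poly (ehrhart_poly (minimal_matroid k n)) (t - 1))
         \<and> (ehrhart_positive M \<longrightarrow> ehrhart_positive (relaxation M H))"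
proof -
  interpret circuit_hyperplane_matroid M H k
    using assms by unfold_locales
  obtain a where a: "k = Suc a" using k_pos gr0_implies_Suc by blast
  have "card (ground M - H) > 0" using E_H_ne finite_E by (simp add: card_gt_0_iff)
  then obtain b where b: "card (ground M - H) = Suc b" using gr0_implies_Suc by blast
  have n: "n = a + b + 2"
    using b a card_H assms(4) card_Diff_subset[OF finite_H H_sub] card_mono[OF finite_E H_sub] by simp
  obtain q :: "real poly" where q: "\<And>t. poly q (real t) = real (diag_sum a b t)"
    and q_deg: "degree q \<le> a + b + 1"
    and q_pos: "\<And>i. 1 \<le> i \<Longrightarrow> i \<le> a + b + 1 \<Longrightarrow> coeff q i > 0"
    using diag_sum_poly[of a b] by blast
  have q0: "coeff q 0 = 0" using q[of 0] by (simp add: diag_sum_def poly_0_coeff_0)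
  \<comment> \<open>Values at the natural numbers determine a polynomial, so the relation of counts
    becomes an identity of polynomials, valid at real arguments.\<close>
  have relax: "ehrhart_poly (relaxation M H) = ehrhart_poly M + q"
  proof (rule ehrhart_poly_eqI)
    fix t :: nat
    have "bases (relaxation M H) = insert H (bases M)" by (simp add: relaxation_def)
    then have "lattice_points (matroid_polytope (relaxation M H)) t
        = {x. in_dilate (insert H (bases M)) (real t) x \<and> integral_fun x}"
      using lattice_points_matroid[of "relaxation M H" t] finite_bases[OF assms(1)] by simp
    then show "poly (ehrhart_poly M + q) (real t)
        = real (card (lattice_points (matroid_polytope (relaxation M H)) t))"
      using card_lattice_relaxation[OF a b, of t] ehrhart_poly_matroid[OF assms(1), of t]
        lattice_points_matroid[OF finite_bases matroidD(2), OF assms(1) assms(1), of t] q[of t]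
      by simp
  qed
  have T: "ehrhart_poly (minimal_matroid k n) = pcompose q [:1, 1:]"
    unfolding a n by (rule ehrhart_minimal_matroid[OF q])
  have "poly (ehrhart_poly (relaxation M H)) t =
      poly (ehrhart_poly M) t + poly (ehrhart_poly (minimal_matroid k n)) (t - 1)" for t
    unfolding relax T by (simp add: poly_pcompose)
  moreover have "ehrhart_positive (relaxation M H)" if "ehrhart_positive M"
    unfolding ehrhart_positive_def relax
  proof (intro allI impI)
    fix i assume i: "i \<le> degree (ehrhart_poly M + q)"
    have p: "coeff (ehrhart_poly M) j > 0" if "j \<le> degree (ehrhart_poly M)" for j
      using \<open>ehrhart_positive M\<close> that by (simp add: ehrhart_positive_def)
    have q_nonneg: "coeff q j \<ge> 0" for j
      using q_pos[of j] q0 coeff_eq_0[of q j] q_deg by (cases "j = 0"; cases "j \<le> a + b + 1") auto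
    show "coeff (ehrhart_poly M + q) i > 0"
    \<comment> \<open>Up to the degree for \<open>M\<close> its own coefficients are positive and
      \<open>q\<close> adds nothing negative. Beyond it, \<open>i\<close> is at least 1 and at most
      the degree of \<open>q\<close>, so \<open>q_pos\<close> applies.\<close>
    proof (cases "i \<le> degree (ehrhart_poly M)")
      case True
      then show ?thesis using p q_nonneg[of i] by (simp add: add_pos_nonneg)
    next
      case False
      then have "i \<le> degree q" using i degree_add_le_max[of "ehrhart_poly M" q] by simp
      then show ?thesis using False q_pos[of i] q_deg by (simp add: coeff_eq_0)
    qed
  qed
  ultimately show ?thesis by blast
qed

end
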